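(* Every $n$-vertex graph $G = (V,E)$ with $m$ edges and minimum degree at least $2$ has a bisection $V = V_1 \cup V_2$ in which both $e(V_1)$ and $e(V_2)$ are at most $\left(\frac13 + o(1)\right) m$. That is: for every $\varepsilon > 0$ there exists $n_0$ such that every graph $G=(V,E)$ with $n > n_0$ vertices, $m$ edges, and minimum degree at least $2$ has a bisection $V = V_1 \cup V_2$ with $e(V_i) \le \left(\frac13 + \varepsilon\right) m$ for both $i = 1,2$.
   Context: Graphs are finite and simple. A bisection of a graph is a bipartition $V = V_1 \cup V_2$ of its vertex set into disjoint parts with $\big||V_1|-|V_2|\big| \le 1$. For a vertex set $U$, $e(U)$ is the number of edges with both endpoints in $U$. The $o(1)$ term tends to $0$ as $n \to \infty$. *)

theory Defs
  imports Complex_Main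
begin

text \<open>A finite simple graph is a finite vertex set \<open>V\<close> with a set \<open>E\<close> of edges, each edge being an
  unordered pair of distinct vertices, represented as a two-element subset of \<open>V\<close>.\<close>

definition simple_graph :: "'a set \<Rightarrow> 'a set set \<Rightarrow> bool" where
  "simple_graph V E \<longleftrightarrow> finite V \<and> E \<subseteq> {e. e \<subseteq> V \<and> card e = 2}"

definition vertex_degree :: "'a set set \<Rightarrow> 'a \<Rightarrow> nat" where
  "vertex_degree E v = card {e \<in> E. v \<in> e}"

text \<open>Being a \<open>Min\<close>, this is meaningful only for finite non-empty \<open>V\<close>.\<close>

definition min_vertex_degree :: "'a set \<Rightarrow> 'a set set \<Rightarrow> nat" where
  "min_vertex_degree V E = Min (vertex_degree E ` V)"

definition edges_inside :: "'a set set \<Rightarrow> 'a set \<Rightarrow> nat" where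
  "edges_inside E U = card {e \<in> E. e \<subseteq> U}"

text \<open>The cardinalities are cast to \<open>int\<close> so that the subtraction does not truncate.\<close>

definition bisection :: "'a set \<Rightarrow> 'a set \<Rightarrow> 'a set \<Rightarrow> bool" where
  "bisection V V1 V2 \<longleftrightarrow>
     V1 \<union> V2 = V \<and> V1 \<inter> V2 = {} \<and> \<bar>int (card V1) - int (card V2)\<bar> \<le> 1"

end

theory Submission
  imports Defs
begin

text \<open>
  Let \<open>A\<close> be the boundedly many vertices of degree at least \<open>\<gamma> m\<close>, and \<open>B\<close> the rest. Split \<open>A\<close> so that
  the difference \<open>\<theta>\<close> of the degree sums of its two sides is as small as possible in absolute value;
  then either \<open>\<theta>\<close> is at most a third of the total, or one side is a single vertex \<open>v\<close>. The
  non-isolated vertices of \<open>G[B]\<close> are covered by disjoint stars in which \<open>k\<close> leaves span at most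
  \<open>k - 1\<close> edges; each star is split into its centre and its leaves. Flip each star, each other
  vertex of \<open>B\<close>, and \<open>A\<close> by independent random signs. Edges between different groups are cut with
  probability \<open>1/2\<close>, and the gain inside the stars is exactly what is needed when one vertex \<open>v\<close>
  dominates, because an isolated vertex of \<open>G[B]\<close> adjacent to \<open>v\<close> is also adjacent to another vertex of \<open>A\<close>.

  With signs \<open>s\<close>, the sum \<open>e(V\<^sub>1) + e(V\<^sub>2)\<close> is a quadratic form in \<open>s\<close>, whereas \<open>e(V\<^sub>1) - e(V\<^sub>2)\<close>
  and \<open>|V\<^sub>1| - |V\<^sub>2|\<close> are linear. Adding large multiples of the squares of the linear forms over \<open>B\<close>
  to the quadratic form therefore lets a single first moment bound control all three. The remaining
  imbalance is repaired by moving vertices of low degree.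
\<close>

section \<open>Signs and averages\<close>

text \<open>Under uniform independent signs every off-diagonal term has mean zero and every diagonal
  term is constant, so the right-hand side is the mean of the form. Fixing the signs one at a time
  replaces the expectation.\<close>

lemma signs_quadratic:
  fixes q :: "'b \<Rightarrow> 'b \<Rightarrow> real"
  assumes "finite I"
  shows "\<exists>\<sigma>. (\<forall>i. \<sigma> i = 1 \<or> \<sigma> i = -1) \<and>
    (\<Sum>i\<in>I. \<Sum>j\<in>I. q i j * (\<sigma> i * \<sigma> j)) \<le> (\<Sum>i\<in>I. q i i)"
  using assms
proof (induction I)
  case empty
  show ?case by (intro exI[of _ "\<lambda>_. 1"]) simp
next
  case (insert x I)
  then obtain \<sigma> where \<sigma>: "\<forall>i. \<sigma> i = 1 \<or> \<sigma> i = -1"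
    and le: "(\<Sum>i\<in>I. \<Sum>j\<in>I. q i j * (\<sigma> i * \<sigma> j)) \<le> (\<Sum>i\<in>I. q i i)"
    by blast
  \<comment> \<open>With the other signs fixed, the new sign \<open>t\<close> enters the form only
    through the term \<open>t * L\<close>, because \<open>t * t = 1\<close>; so \<open>t\<close> is
    taken opposite to \<open>L\<close>.\<close>
  define L where "L = (\<Sum>j\<in>I. (q x j + q j x) * \<sigma> j)"
  define t :: real where "t = (if L \<le> 0 then 1 else -1)"
  define \<tau> where "\<tau> = \<sigma>(x := t)"
  have \<tau>I: "\<tau> i = \<sigma> i" if "i \<in> I" for i
    using that insert.hyps by (auto simp: \<tau>_def)
  have \<tau>x: "\<tau> x = t" by (simp add: \<tau>_def)
  have tt: "t * t = 1" by (simp add: t_def)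
  have "(\<Sum>i\<in>insert x I. \<Sum>j\<in>insert x I. q i j * (\<tau> i * \<tau> j)) =
      q x x * (t * t) + (\<Sum>j\<in>I. q x j * (t * \<sigma> j)) + (\<Sum>i\<in>I. q i x * (\<sigma> i * t))
      + (\<Sum>i\<in>I. \<Sum>j\<in>I. q i j * (\<sigma> i * \<sigma> j))"
    using insert.hyps by (simp add: sum.distrib \<tau>x \<tau>I cong: sum.cong)
  also have "(\<Sum>j\<in>I. q x j * (t * \<sigma> j)) + (\<Sum>i\<in>I. q i x * (\<sigma> i * t)) = t * L"
    unfolding L_def sum_distrib_left sum.distrib[symmetric]
    by (rule sum.cong) (auto simp: algebra_simps)
  then have "q x x * (t * t) + (\<Sum>j\<in>I. q x j * (t * \<sigma> j)) + (\<Sum>i\<in>I. q i x * (\<sigma> i * t))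
      + (\<Sum>i\<in>I. \<Sum>j\<in>I. q i j * (\<sigma> i * \<sigma> j))
      = q x x + t * L + (\<Sum>i\<in>I. \<Sum>j\<in>I. q i j * (\<sigma> i * \<sigma> j))"
    using tt by simp
  also have "t * L \<le> 0" by (simp add: t_def)
  then have "q x x + t * L + (\<Sum>i\<in>I. \<Sum>j\<in>I. q i j * (\<sigma> i * \<sigma> j)) \<le> (\<Sum>i\<in>insert x I. q i i)"
    using le insert.hyps by simp
  finally have "(\<Sum>i\<in>insert x I. \<Sum>j\<in>insert x I. q i j * (\<tau> i * \<tau> j)) \<le> (\<Sum>i\<in>insert x I. q i i)" .
  moreover have "\<forall>i. \<tau> i = 1 \<or> \<tau> i = -1"
    using \<sigma> by (auto simp: \<tau>_def t_def)
  ultimately show ?case by blast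
qed

text \<open>Vertices with the same label share one sign, so the form collapses to a form
  \<open>q\<close> on the labels whose diagonal entry \<open>q i i\<close> collects all pairs inside
  group \<open>i\<close>.\<close>

lemma signs_quadratic_grouped:
  fixes w :: "'a \<Rightarrow> 'a \<Rightarrow> real" and g :: "'a \<Rightarrow> 'b"
  assumes "finite V"
  shows "\<exists>\<sigma>. (\<forall>i. \<sigma> i = 1 \<or> \<sigma> i = -1) \<and>
    (\<Sum>u\<in>V. \<Sum>v\<in>V. w u v * (\<sigma> (g u) * \<sigma> (g v)))
      \<le> (\<Sum>u\<in>V. \<Sum>v\<in>{v\<in>V. g v = g u}. w u v)"
proof -
  define q where "q i j = (\<Sum>u\<in>{u\<in>V. g u = i}. \<Sum>v\<in>{v\<in>V. g v = j}. w u v)" for i j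
  obtain \<sigma> :: "'b \<Rightarrow> real" where \<sigma>: "\<forall>i. \<sigma> i = 1 \<or> \<sigma> i = -1"
    and le: "(\<Sum>i\<in>g ` V. \<Sum>j\<in>g ` V. q i j * (\<sigma> i * \<sigma> j)) \<le> (\<Sum>i\<in>g ` V. q i i)"
    using signs_quadratic[of "g ` V" q] assms by blast
  have inner: "(\<Sum>j\<in>g ` V. \<Sum>v\<in>{v\<in>V. g v = j}. w u v * (\<sigma> i * \<sigma> j))
      = (\<Sum>v\<in>V. w u v * (\<sigma> i * \<sigma> (g v)))" for u i
    by (subst sum.image_gen[OF assms, of _ g]) (intro sum.cong, auto)
  have "(\<Sum>i\<in>g ` V. \<Sum>j\<in>g ` V. q i j * (\<sigma> i * \<sigma> j))
      = (\<Sum>i\<in>g ` V. \<Sum>u\<in>{u\<in>V. g u = i}. \<Sum>j\<in>g ` V. \<Sum>v\<in>{v\<in>V. g v = j}. w u v * (\<sigma> i * \<sigma> j))"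
    unfolding q_def sum_distrib_right by (intro sum.cong refl sum.swap)
  also have "\<dots> = (\<Sum>i\<in>g ` V. \<Sum>u\<in>{u\<in>V. g u = i}. \<Sum>v\<in>V. w u v * (\<sigma> i * \<sigma> (g v)))"
    by (simp only: inner)
  also have "\<dots> = (\<Sum>u\<in>V. \<Sum>v\<in>V. w u v * (\<sigma> (g u) * \<sigma> (g v)))"
    by (subst (2) sum.image_gen[OF assms, of _ g]) (intro sum.cong, auto)
  finally have 1: "(\<Sum>u\<in>V. \<Sum>v\<in>V. w u v * (\<sigma> (g u) * \<sigma> (g v)))
    = (\<Sum>i\<in>g ` V. \<Sum>j\<in>g ` V. q i j * (\<sigma> i * \<sigma> j))" ..
  have 2: "(\<Sum>i\<in>g ` V. q i i) = (\<Sum>u\<in>V. \<Sum>v\<in>{v\<in>V. g v = g u}. w u v)"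
    unfolding q_def by (subst sum.image_gen[OF assms, of "\<lambda>u. \<Sum>v\<in>{v\<in>V. g v = g u}. w u v" g])
      (intro sum.cong, auto)
  show ?thesis using le \<sigma> unfolding 1[symmetric] 2 by blast
qed

text \<open>Removing an element of largest weight never raises the average. The induction therefore
  runs downwards from \<open>W\<close> itself.\<close>

lemma subset_sum_le_average:
  fixes d :: "'a \<Rightarrow> real"
  assumes "finite W" "k \<le> card W"
  shows "\<exists>R\<subseteq>W. card R = k \<and> real (card W) * sum d R \<le> real k * sum d W"
  using assms(2)
proof (induction k rule: inc_induct)
  case base
  show ?case by (intro exI[of _ W]) simp
next
  case (step k)
  then obtain R where R: "R \<subseteq> W" "card R = Suc k"
    and le: "real (card W) * sum d R \<le> real (Suc k) * sum d W" by blast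
  have fin: "finite R" using R assms finite_subset by blast
  have "R \<noteq> {}" using R by auto
  then have "Max (d ` R) \<in> d ` R" using fin by simp
  then obtain x where x: "x \<in> R" and "d x = Max (d ` R)" by auto
  then have max: "d y \<le> d x" if "y \<in> R" for y using fin that by simp
  have sumR: "sum d R = d x + sum d (R - {x})" using fin x by (simp add: sum.remove)
  have "sum d (R - {x}) \<le> real (card (R - {x})) * d x"
    using max by (intro sum_bounded_above) auto
  then have a: "sum d (R - {x}) \<le> real k * d x" using R x fin by simp
  have "real (Suc k) * sum d (R - {x}) \<le> real k * sum d R"
    using a sumR by (simp add: algebra_simps)
  from mult_left_mono[OF this, of "real (card W)"]
  have "real (Suc k) * (real (card W) * sum d (R - {x})) \<le> real k * (real (card W) * sum d R)"
    by (simp add: ac_simps)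
  also have "\<dots> \<le> real k * (real (Suc k) * sum d W)"
    using le by (intro mult_left_mono) auto
  finally have "real (Suc k) * (real (card W) * sum d (R - {x})) \<le> real (Suc k) * (real k * sum d W)"
    by (simp add: mult.left_commute)
  then have "real (card W) * sum d (R - {x}) \<le> real k * sum d W"
    by (rule mult_left_le_imp_le) simp
  then show ?case using R x fin by (intro exI[of _ "R - {x}"]) auto
qed

text \<open>Take a split whose difference \<theta> is least in absolute value. Moving
  \<open>u\<close> out of the heavier side \<open>T\<close> changes the difference by
  \<open>2 * w u\<close>, so minimality forces \<open>w u\<close> to be at least \<theta>. Two such
  elements give \<open>sum w T\<close> at least 2\<theta>, and then \<open>sum w A\<close>, which is
  twice \<open>sum w T\<close> minus \<theta>, is at least 3\<theta>.\<close>

lemma near_balanced_subset: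
  fixes w :: "'a \<Rightarrow> real"
  assumes "finite A" and pos: "\<And>u. u \<in> A \<Longrightarrow> w u > 0"
  shows "\<exists>T\<subseteq>A. 0 \<le> sum w T - sum w (A - T) \<and>
    (3 * (sum w T - sum w (A - T)) \<le> sum w A \<or> (\<exists>v\<in>A. T = {v}))"
proof -
  define \<theta> where "\<theta> T = sum w T - sum w (A - T)" for T
  have split: "sum w A = sum w T + sum w (A - T)" if "T \<subseteq> A" for T
    using sum.subset_diff[OF that assms(1), of w] by simp
  obtain T0 where T0: "T0 \<subseteq> A" and min0: "\<And>T. T \<subseteq> A \<Longrightarrow> \<bar>\<theta> T0\<bar> \<le> \<bar>\<theta> T\<bar>"
  proof -
    have "\<exists>m\<in>Pow A. \<not> (\<exists>x\<in>Pow A. \<bar>\<theta> x\<bar> < \<bar>\<theta> m\<bar>)"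
      using ex_min_if_finite[of "(\<lambda>T. \<bar>\<theta> T\<bar>) ` Pow A"] assms(1)
      by (simp add: Pow_not_empty)
    then show ?thesis using that by (meson Pow_iff not_le)
  qed
  \<comment> \<open>Passing to the complement only changes the sign of the difference, so the
    minimiser may be taken with nonnegative difference.\<close>
  define T where "T = (if \<theta> T0 \<ge> 0 then T0 else A - T0)"
  have TA: "T \<subseteq> A" using T0 by (auto simp: T_def)
  have \<theta>T: "\<theta> T = \<bar>\<theta> T0\<bar>"
    using T0 by (auto simp: T_def \<theta>_def double_diff)
  have min: "\<theta> T \<le> \<bar>\<theta> S\<bar>" if "S \<subseteq> A" for S using min0[OF that] \<theta>T by simp
  have ge: "w u \<ge> \<theta> T" if u: "u \<in> T" for u
  proof -
    have uA: "u \<in> A" using u TA by auto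
    have "sum w T = w u + sum w (T - {u})" 
      using sum.remove[OF finite_subset[OF TA assms(1)] u] .
    moreover have "T - {u} \<subseteq> A" using TA by blast
    ultimately have "\<theta> (T - {u}) = \<theta> T - 2 * w u"
      using split[OF TA] split[of "T - {u}"] by (simp add: \<theta>_def)
    then show ?thesis using min[OF \<open>T - {u} \<subseteq> A\<close>] pos[OF uA] by linarith
  qed
  have "\<exists>v\<in>A. T = {v}" if big: "3 * \<theta> T > sum w A"
  proof (rule ccontr)
    assume no: "\<not> (\<exists>v\<in>A. T = {v})"
    have nn: "sum w S \<ge> 0" if "S \<subseteq> A" for S using pos that by (intro sum_nonneg) (meson less_imp_le subsetD)
    have "\<theta> T > 0" using big nn[of A] by simp
    then have "T \<noteq> {}" using nn[of A] by (auto simp: \<theta>_def)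
    then obtain u where u: "u \<in> T" by blast
    then obtain v where v: "v \<in> T" "v \<noteq> u" using no TA by blast
    have "sum w {u, v} \<le> sum w T"
      using u v TA assms(1) pos by (intro sum_mono2) (auto intro: finite_subset less_imp_le)
    then have "2 * \<theta> T \<le> sum w T" using ge[OF u] ge[OF v(1)] v by simp
    then show False using big split[OF TA] by (simp add: \<theta>_def)
  qed
  moreover have "0 \<le> \<theta> T" using \<theta>T by simp
  ultimately show ?thesis using TA unfolding \<theta>_def by (meson not_le)
qed

section \<open>Star decompositions\<close>

text \<open>Real-valued, so that degrees, edge counts and signed edge counts all become sums over
  vertices. Double sums run over ordered pairs and thus see each edge twice.\<close>

definition adj :: "'a set set \<Rightarrow> 'a \<Rightarrow> 'a \<Rightarrow> real" where
  "adj E u v = of_bool ({u, v} \<in> E)"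

lemma adj_nonneg: "0 \<le> adj E u v"
  by (simp add: adj_def)

lemma adj_le_1: "adj E u v \<le> 1"
  by (simp add: adj_def)

lemma adj_commute: "adj E u v = adj E v u"
  by (simp add: adj_def insert_commute)

lemma simple_graph_loopfree: "simple_graph V E \<Longrightarrow> {u} \<notin> E"
  by (auto simp: simple_graph_def)

lemma simple_graph_edge_in: "simple_graph V E \<Longrightarrow> {u, v} \<in> E \<Longrightarrow> u \<in> V \<and> v \<in> V"
  by (auto simp: simple_graph_def)

lemma simple_graph_finite: "simple_graph V E \<Longrightarrow> finite V \<and> finite E"
  by (auto simp: simple_graph_def intro: finite_subset[of E "Pow V"])

lemma simple_graph_edgeE:
  assumes "simple_graph V E" "e \<in> E"
  obtains a b where "e = {a, b}" "a \<noteq> b"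
proof -
  have "card e = 2" using assms by (auto simp: simple_graph_def)
  then show thesis using that by (auto simp: card_2_iff)
qed

lemma double_sum_adj:
  assumes "simple_graph V E" "W \<subseteq> V"
  shows "(\<Sum>u\<in>W. \<Sum>v\<in>W. adj E u v) = 2 * real (edges_inside E W)"
proof -
  have fin: "finite E" "finite W"
    using simple_graph_finite[OF assms(1)] assms(2) finite_subset by auto
  have adj: "adj E u v = (\<Sum>e\<in>E. of_bool ({u, v} = e))" for u v
    unfolding adj_def using fin(1) by (simp add: of_bool_def)
  have inner: "(\<Sum>u\<in>W. \<Sum>v\<in>W. of_bool ({u, v} = e)) = (2 * of_bool (e \<subseteq> W) :: real)" if eE: "e \<in> E" for e
  proof -
    obtain a b where e: "e = {a, b}" "a \<noteq> b"
      using simple_graph_edgeE[OF assms(1) eE] .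
    \<comment> \<open>As \<open>a\<close> and \<open>b\<close> are distinct, the two ordered pairs
      that form \<open>e\<close> are different, and each indicator is a product that factors through
      the double sum.\<close>
    have 1: "of_bool ({u, v} = e) = (of_bool (u = a) * of_bool (v = b) + of_bool (u = b) * of_bool (v = a) :: real)" for u v
      using e by (auto simp: doubleton_eq_iff)
    have 2: "(\<Sum>u\<in>W. of_bool (u = x)) = (of_bool (x \<in> W) :: real)" for x
      using fin(2) by (simp add: of_bool_def)
    show ?thesis unfolding 1
      by (simp add: sum.distrib sum_distrib_left[symmetric] sum_distrib_right[symmetric] 2 e(1) del: of_bool_eq_iff)
  qed
  have "(\<Sum>u\<in>W. \<Sum>v\<in>W. adj E u v) = (\<Sum>e\<in>E. \<Sum>u\<in>W. \<Sum>v\<in>W. of_bool ({u, v} = e))"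
  proof -
    have "(\<Sum>u\<in>W. \<Sum>v\<in>W. adj E u v) = (\<Sum>u\<in>W. \<Sum>e\<in>E. \<Sum>v\<in>W. of_bool ({u, v} = e))"
      unfolding adj by (intro sum.cong refl sum.swap)
    also have "\<dots> = (\<Sum>e\<in>E. \<Sum>u\<in>W. \<Sum>v\<in>W. of_bool ({u, v} = e))"
      by (rule sum.swap)
    finally show ?thesis .
  qed
  also have "\<dots> = (\<Sum>e\<in>E. 2 * of_bool (e \<subseteq> W))"
    by (intro sum.cong refl inner)
  also have "\<dots> = 2 * real (edges_inside E W)"
    using fin(1) by (simp add: edges_inside_def sum_distrib_left[symmetric] Collect_conj_eq Int_commute)
  finally show ?thesis .
qed

lemma double_sum_adj_all:
  assumes "simple_graph V E"
  shows "(\<Sum>u\<in>V. \<Sum>v\<in>V. adj E u v) = 2 * real (card E)"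
proof -
  have "{e \<in> E. e \<subseteq> V} = E" using assms by (auto simp: simple_graph_def)
  then show ?thesis using double_sum_adj[OF assms subset_refl] by (simp add: edges_inside_def)
qed

lemma vertex_degree_eq_sum:
  assumes "simple_graph V E"
  shows "real (vertex_degree E v) = (\<Sum>u\<in>V. adj E v u)"
proof -
  have "{e \<in> E. v \<in> e} = (\<lambda>u. {v, u}) ` {u \<in> V. {v, u} \<in> E}"
  proof (intro equalityI subsetI)
    fix e assume e: "e \<in> {e \<in> E. v \<in> e}"
    then obtain a b where ab: "e = {a, b}" using simple_graph_edgeE[OF assms] by blast
    then obtain u where "e = {v, u}" using e by (auto simp: insert_commute)
    then show "e \<in> (\<lambda>u. {v, u}) ` {u \<in> V. {v, u} \<in> E}"
      using e simple_graph_edge_in[OF assms, of v u] by auto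
  qed auto
  then have "vertex_degree E v = card {u \<in> V. {v, u} \<in> E}"
    unfolding vertex_degree_def
    by (simp add: card_image inj_on_def doubleton_eq_iff)
  then show ?thesis
    using simple_graph_finite[OF assms] by (simp add: adj_def Collect_conj_eq Int_commute)
qed

text \<open>\<open>c\<close> sends every vertex to the centre of its star. The last condition says that the leaves
  of a star with \<open>k\<close> leaves span at most \<open>k - 1\<close> edges; in particular \<open>k \<ge> 1\<close>.\<close>

definition star_map :: "'a set set \<Rightarrow> 'a set \<Rightarrow> ('a \<Rightarrow> 'a) \<Rightarrow> bool" where
  "star_map E B c \<longleftrightarrow>
     (\<forall>u\<in>B. c u \<in> B \<and> c (c u) = c u \<and> (c u \<noteq> u \<longrightarrow> {u, c u} \<in> E)) \<and>
     (\<forall>z\<in>B. c z = z \<longrightarrow>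
        (\<Sum>u\<in>{u\<in>B - {z}. c u = z}. \<Sum>v\<in>{u\<in>B - {z}. c u = z}. adj E u v)
          \<le> 2 * (real (card {u\<in>B - {z}. c u = z}) - 1))"

text \<open>Each map sends its own ground set into itself, so by disjointness no star of the
  combined map mixes the two sets.\<close>

lemma star_map_Un:
  assumes "star_map E B1 c1" "star_map E B2 c2" "B1 \<inter> B2 = {}"
  shows "star_map E (B1 \<union> B2) (\<lambda>u. if u \<in> B1 then c1 u else c2 u)"
proof -
  have out: "u \<notin> B1" if "u \<in> B2" for u using assms(3) that by auto
  have c1: "c1 u \<in> B1" "c1 (c1 u) = c1 u" "c1 u \<noteq> u \<Longrightarrow> {u, c1 u} \<in> E" if "u \<in> B1" for u
    using assms(1) that by (auto simp: star_map_def)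
  have c2: "c2 u \<in> B2" "c2 u \<notin> B1" "c2 (c2 u) = c2 u" "c2 u \<noteq> u \<Longrightarrow> {u, c2 u} \<in> E" if "u \<in> B2" for u
    using assms(2) that out by (auto simp: star_map_def)
  have F1: "{u\<in>(B1 \<union> B2) - {z}. (if u \<in> B1 then c1 u else c2 u) = z} = {u\<in>B1 - {z}. c1 u = z}"
    if z: "z \<in> B1" for z
  proof -
    have "c2 u \<noteq> z" if "u \<in> B2" for u using c2(2)[OF that] z by auto
    then show ?thesis using out by auto
  qed
  have F2: "{u\<in>(B1 \<union> B2) - {z}. (if u \<in> B1 then c1 u else c2 u) = z} = {u\<in>B2 - {z}. c2 u = z}"
    if z: "z \<in> B2" for z
  proof -
    have "c1 u \<noteq> z" if "u \<in> B1" for u using c1(1)[OF that] out[OF z] by auto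
    then show ?thesis using out by auto
  qed
  show ?thesis
    unfolding star_map_def
  proof (intro conjI ballI impI, goal_cases)
    case (4 z)
    show ?case
    proof (cases "z \<in> B1")
      case True
      then show ?thesis using 4 assms(1) unfolding F1[OF True] by (auto simp: star_map_def)
    next
      case False
      then have z: "z \<in> B2" using 4 by auto
      then show ?thesis using 4 False assms(2) unfolding F2[OF z] by (auto simp: star_map_def)
    qed
  qed (use c1 c2 out in auto)
qed

lemma star_map_single:
  assumes "z \<notin> F" "\<And>u. u \<in> F \<Longrightarrow> {u, z} \<in> E"
    "(\<Sum>u\<in>F. \<Sum>v\<in>F. adj E u v) \<le> 2 * (real (card F) - 1)"
  shows "star_map E (insert z F) (\<lambda>_. z)"
proof -
  have "{u \<in> insert z F - {z}. z = z} = F" using assms(1) by auto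
  with assms(3) have "(\<Sum>u\<in>{u\<in>insert z F - {z}. z = z}. \<Sum>v\<in>{u\<in>insert z F - {z}. z = z}. adj E u v)
      \<le> 2 * (real (card {u\<in>insert z F - {z}. z = z}) - 1)" by (simp only:)
  then show ?thesis
    using assms(2) unfolding star_map_def by blast
qed

lemma star_map_independent:
  assumes "finite J" "J \<noteq> {}" "z \<notin> J" "\<And>u. u \<in> J \<Longrightarrow> {u, z} \<in> E"
    "\<And>u v. u \<in> J \<Longrightarrow> v \<in> J \<Longrightarrow> {u, v} \<notin> E"
  shows "star_map E (insert z J) (\<lambda>_. z)"
proof (rule star_map_single)
  have "(\<Sum>u\<in>J. \<Sum>v\<in>J. adj E u v) = 0" using assms(5) by (simp add: adj_def)
  moreover have "card J \<ge> 1" using assms by (simp add: Suc_leI card_gt_0_iff)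
  ultimately show "(\<Sum>u\<in>J. \<Sum>v\<in>J. adj E u v) \<le> 2 * (real (card J) - 1)" by simp
qed (use assms in auto)

text \<open>The leaves are \<open>b\<close> and \<open>J\<close>. Since \<open>J\<close> is
  independent, every edge among them joins \<open>b\<close> to \<open>J\<close>; there are at most
  \<open>card J\<close> of these, one less than the number of leaves.\<close>

lemma star_map_insert_independent:
  assumes "finite J" "a \<noteq> b" "{a, b} \<in> E" "a \<notin> J" "b \<notin> J" "\<And>u. {u} \<notin> E"
    "\<And>u. u \<in> J \<Longrightarrow> {u, a} \<in> E"
    "\<And>u v. u \<in> J \<Longrightarrow> v \<in> J \<Longrightarrow> {u, v} \<notin> E"
  shows "star_map E (insert a (insert b J)) (\<lambda>_. a)"
proof (rule star_map_single)
  have "(\<Sum>u\<in>insert b J. \<Sum>v\<in>insert b J. adj E u v)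
      = adj E b b + (\<Sum>v\<in>J. adj E b v) + (\<Sum>u\<in>J. adj E u b) + (\<Sum>u\<in>J. \<Sum>v\<in>J. adj E u v)"
    using assms(1,5) by (simp add: sum.distrib)
  also have "\<dots> = (\<Sum>v\<in>J. adj E b v) + (\<Sum>u\<in>J. adj E u b)"
    using assms(6,8) by (simp add: adj_def)
  also have "\<dots> \<le> real (card J) * 1 + real (card J) * 1"
    by (intro add_mono sum_bounded_above adj_le_1)
  finally show "(\<Sum>u\<in>insert b J. \<Sum>v\<in>insert b J. adj E u v) \<le> 2 * (real (card (insert b J)) - 1)"
    using assms by simp
qed (use assms in \<open>auto simp: insert_commute\<close>)

text \<open>Remove the ends of an edge \<open>{a, b}\<close> together with the set \<open>I\<close>
  of vertices isolated by this. What is left has no isolated vertex and is covered by induction; the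
  removed vertices form one or two stars centred at \<open>a\<close> or \<open>b\<close>.\<close>

lemma star_map_exists:
  assumes "finite B" "\<And>u. {u} \<notin> E" "\<And>u. u \<in> B \<Longrightarrow> \<exists>v\<in>B. {u, v} \<in> E"
  shows "\<exists>c. star_map E B c"
  using assms(1,3)
proof (induction B rule: finite_psubset_induct)
  case (psubset B)
  show ?case
  proof (cases "B = {}")
    case True
    then show ?thesis by (auto simp: star_map_def)
  next
    case False
    then obtain a b where ab: "a \<in> B" "b \<in> B" "{a, b} \<in> E" using psubset.prems by blast
    have "{b, a} \<in> E" using ab by (simp add: insert_commute)
    have ne: "a \<noteq> b" using ab assms(2)[of a] by auto
    define B' where "B' = B - {a, b}"
    define I where "I = {u\<in>B'. \<forall>v\<in>B'. {u, v} \<notin> E}"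
    define Ia where "Ia = {u\<in>I. {u, a} \<in> E}"
    \<comment> \<open>A vertex of \<open>I\<close> had a neighbour in \<open>B\<close>, which can
      only be \<open>a\<close> or \<open>b\<close>. Those adjacent to \<open>a\<close> are assigned
      to \<open>a\<close>, so the remaining ones are adjacent to \<open>b\<close>.\<close>
    define Ib where "Ib = I - Ia"
    have fin: "finite Ia" "finite Ib"
      using psubset.hyps by (auto simp: Ia_def Ib_def I_def B'_def)
    have sub: "Ia \<subseteq> B'" "Ib \<subseteq> B'" "I \<subseteq> B'" by (auto simp: Ia_def Ib_def I_def)
    have notin: "a \<notin> Ia" "a \<notin> Ib" "b \<notin> Ia" "b \<notin> Ib" using sub by (auto simp: B'_def)
    have indep: "{u, v} \<notin> E" if "u \<in> I" "v \<in> I" for u v using that by (auto simp: I_def)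
    have Ia: "{u, a} \<in> E" if "u \<in> Ia" for u using that by (auto simp: Ia_def)
    have Ib: "{u, b} \<in> E" if "u \<in> Ib" for u
    proof -
      have u: "u \<in> I" "{u, a} \<notin> E" using that by (auto simp: Ia_def Ib_def)
      then have "u \<in> B" using sub by (auto simp: B'_def)
      then obtain v where v: "v \<in> B" "{u, v} \<in> E" using psubset.prems by blast
      then have "v \<notin> B'" using u by (auto simp: I_def)
      then show ?thesis using v u by (auto simp: B'_def)
    qed
    have "\<exists>c. star_map E (B' - I) c"
    proof (rule psubset.IH)
      show "B' - I \<subset> B" using ab by (auto simp: B'_def)
      fix u assume u: "u \<in> B' - I"
      then obtain v where v: "v \<in> B'" "{u, v} \<in> E" by (auto simp: I_def)
      then have "{v, u} \<in> E" by (simp add: insert_commute)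
      then have "v \<notin> I" using u by (auto simp: I_def)
      then show "\<exists>v\<in>B' - I. {u, v} \<in> E" using v by auto
    qed
    then obtain c where c: "star_map E (B' - I) c" by blast
    have "\<exists>c. star_map E ({a, b} \<union> I) c"
    \<comment> \<open>If one class is empty, its end of the edge would be a star without leaves, so
      it becomes an additional leaf of the other end. Otherwise there are two stars with independent
      leaf sets.\<close>
    proof (cases "Ia = {} \<or> Ib = {}")
      case True
      then consider "Ib = {}" "Ia = I" | "Ia = {}" "Ib = I" by (auto simp: Ia_def Ib_def)
      then show ?thesis
      proof cases
        case 1
        then have "star_map E (insert a (insert b I)) (\<lambda>_. a)"
          using fin notin Ia indep ab ne assms(2) by (intro star_map_insert_independent) auto
        then show ?thesis by auto
      next
        case 2
        then have s: "star_map E (insert b (insert a I)) (\<lambda>_. b)"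
          using fin notin Ib indep ab ne assms(2) \<open>{b, a} \<in> E\<close>
          by (intro star_map_insert_independent) auto
        have eq: "insert b (insert a I) = {a, b} \<union> I" by auto
        show ?thesis by (rule exI, rule s[unfolded eq])
      qed
    next
      case False
      have "Ia \<subseteq> I" "Ib \<subseteq> I" by (auto simp: Ia_def Ib_def)
      then have "{u, v} \<notin> E" if "u \<in> Ia \<and> v \<in> Ia \<or> u \<in> Ib \<and> v \<in> Ib" for u v
        using indep that by blast
      note indep' = this
      have "star_map E (insert a Ia) (\<lambda>_. a)"
        by (rule star_map_independent) (use False fin notin Ia indep' in blast)+
      moreover have "star_map E (insert b Ib) (\<lambda>_. b)"
        by (rule star_map_independent) (use False fin notin Ib indep' in blast)+
      moreover have "insert a Ia \<inter> insert b Ib = {}"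
        using notin ne by (auto simp: Ib_def)
      ultimately have "\<exists>c. star_map E (insert a Ia \<union> insert b Ib) c"
        by (intro exI, rule star_map_Un)
      moreover have "insert a Ia \<union> insert b Ib = {a, b} \<union> I"
        by (auto simp: Ib_def Ia_def)
      ultimately show ?thesis by (simp only:)
    qed
    then obtain c' where "star_map E ({a, b} \<union> I) c'" by blast
    moreover have "({a, b} \<union> I) \<inter> (B' - I) = {}" by (auto simp: B'_def)
    ultimately have "\<exists>c. star_map E (({a, b} \<union> I) \<union> (B' - I)) c"
      by (intro exI, rule star_map_Un[OF _ c])
    moreover have "({a, b} \<union> I) \<union> (B' - I) = B"
      using ab sub by (auto simp: B'_def)
    ultimately show ?thesis by (simp only:)
  qed
qed

section \<open>Partitions from signs\<close>

lemma sum_vertex_degree: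
  assumes "simple_graph V E"
  shows "(\<Sum>u\<in>V. real (vertex_degree E u)) = 2 * real (card E)"
  using double_sum_adj_all[OF assms] by (simp add: vertex_degree_eq_sum[OF assms])

lemma edges_inside_mono:
  assumes "finite E" "U \<subseteq> W"
  shows "edges_inside E U \<le> edges_inside E W"
  unfolding edges_inside_def using assms by (intro card_mono) auto

lemma edges_inside_Un_le:
  assumes "finite E" "finite R"
  shows "edges_inside E (W \<union> R) \<le> edges_inside E W + (\<Sum>r\<in>R. vertex_degree E r)"
proof -
  have "{e \<in> E. e \<subseteq> W \<union> R} \<subseteq> {e \<in> E. e \<subseteq> W} \<union> (\<Union>r\<in>R. {e \<in> E. r \<in> e})" by auto
  then have "edges_inside E (W \<union> R) \<le> card ({e \<in> E. e \<subseteq> W} \<union> (\<Union>r\<in>R. {e \<in> E. r \<in> e}))"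
    unfolding edges_inside_def using assms by (intro card_mono) auto
  also have "\<dots> \<le> card {e \<in> E. e \<subseteq> W} + card (\<Union>r\<in>R. {e \<in> E. r \<in> e})"
    by (rule card_Un_le)
  also have "card (\<Union>r\<in>R. {e \<in> E. r \<in> e}) \<le> (\<Sum>r\<in>R. vertex_degree E r)"
    unfolding vertex_degree_def by (rule card_UN_le[OF assms(2)])
  finally show ?thesis by (simp add: edges_inside_def)
qed

text \<open>Half of the surplus is moved out of the larger part, using vertices whose mean degree is
  at most the mean over \<open>W1\<close>. As \<open>W1\<close> has at least half of all vertices,
  their degree sum is at most \<open>2 * k\<close> times the mean degree in the whole graph, and it
  bounds the number of edges gained by \<open>W2\<close>.\<close>

lemma rebalance_aux:
  fixes M D :: real
  assumes G: "simple_graph V E" and W: "W1 \<union> W2 = V" "W1 \<inter> W2 = {}" and "V \<noteq> {}"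
    and le: "card W2 \<le> card W1"
    and M: "real (edges_inside E W1) \<le> M" "real (edges_inside E W2) \<le> M"
    and D: "real (card W1) - real (card W2) \<le> D"
  shows "\<exists>V1 V2. bisection V V1 V2 \<and>
    real (edges_inside E V1) \<le> M + 2 * D * real (card E) / real (card V) \<and>
    real (edges_inside E V2) \<le> M + 2 * D * real (card E) / real (card V)"
proof -
  have fin: "finite V" "finite E" "finite W1" "finite W2"
    using simple_graph_finite[OF G] W(1) by auto
  \<comment> \<open>Rounding down leaves a difference of 0 or 1 after the move.\<close>
  define k where "k = (card W1 - card W2) div 2"
  have kW1: "k \<le> card W1" by (simp add: k_def)
  obtain R where R: "R \<subseteq> W1" "card R = k"
    and avg: "real (card W1) * (\<Sum>u\<in>R. real (vertex_degree E u))
      \<le> real k * (\<Sum>u\<in>W1. real (vertex_degree E u))"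
    using subset_sum_le_average[OF fin(3) kW1, of "\<lambda>u. real (vertex_degree E u)"] by auto
  have finR: "finite R" using R fin finite_subset by blast
  define x where "x = (\<Sum>u\<in>R. real (vertex_degree E u))"
  have x0: "x \<ge> 0" by (simp add: x_def sum_nonneg)
  have n: "card V = card W1 + card W2" using W fin by (metis card_Un_disjoint)
  have npos: "real (card V) > 0" using \<open>V \<noteq> {}\<close> fin by (simp add: card_gt_0_iff)
  have "(\<Sum>u\<in>W1. real (vertex_degree E u)) \<le> (\<Sum>u\<in>V. real (vertex_degree E u))"
    using W fin by (intro sum_mono2) auto
  then have "real k * (\<Sum>u\<in>W1. real (vertex_degree E u)) \<le> real k * (2 * real (card E))"
    unfolding sum_vertex_degree[OF G] by (rule mult_left_mono) simp
  moreover have "real (card V) * x \<le> 2 * (real (card W1) * x)"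
    using le n x0 mult_right_mono[of "real (card V)" "2 * real (card W1)" x] by simp
  ultimately have "real (card V) * x \<le> (2 * real k) * (2 * real (card E))"
    using avg by (simp add: x_def)
  also have "\<dots> \<le> D * (2 * real (card E))"
  proof (rule mult_right_mono)
    have "2 * k \<le> card W1 - card W2" by (simp add: k_def)
    then have "real (2 * k) \<le> real (card W1 - card W2)" by (rule of_nat_mono)
    then show "2 * real k \<le> D" using D le by (simp add: of_nat_diff)
  qed simp
  finally have x: "x \<le> 2 * D * real (card E) / real (card V)"
    using npos by (simp add: pos_le_divide_eq algebra_simps)
  have "edges_inside E (W2 \<union> R) \<le> edges_inside E W2 + (\<Sum>r\<in>R. vertex_degree E r)"
    by (rule edges_inside_Un_le[OF fin(2) finR])
  then have "real (edges_inside E (W2 \<union> R)) \<le> real (edges_inside E W2) + x"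
    unfolding x_def of_nat_sum[symmetric] of_nat_add[symmetric] by (rule of_nat_mono)
  then have e2: "real (edges_inside E (W2 \<union> R)) \<le> M + 2 * D * real (card E) / real (card V)"
    using M x by linarith
  have "edges_inside E (W1 - R) \<le> edges_inside E W1"
    by (rule edges_inside_mono[OF fin(2)]) auto
  then have e1: "real (edges_inside E (W1 - R)) \<le> M + 2 * D * real (card E) / real (card V)"
    using M x x0 by linarith
  have "card (W1 - R) = card W1 - k" using R finR by (simp add: card_Diff_subset)
  moreover have "card (W2 \<union> R) = card W2 + k"
    using R finR fin W by (subst card_Un_disjoint) auto
  ultimately have "\<bar>int (card (W1 - R)) - int (card (W2 \<union> R))\<bar> \<le> 1"
    using le kW1 unfolding k_def by linarith
  then have "bisection V (W1 - R) (W2 \<union> R)"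
    using W R by (auto simp: bisection_def)
  then show ?thesis using e1 e2 by blast
qed

lemma rebalance:
  fixes M D :: real
  assumes "simple_graph V E" "W1 \<union> W2 = V" "W1 \<inter> W2 = {}" "V \<noteq> {}"
    "real (edges_inside E W1) \<le> M" "real (edges_inside E W2) \<le> M"
    "\<bar>real (card W1) - real (card W2)\<bar> \<le> D"
  shows "\<exists>V1 V2. bisection V V1 V2 \<and>
    real (edges_inside E V1) \<le> M + 2 * D * real (card E) / real (card V) \<and>
    real (edges_inside E V2) \<le> M + 2 * D * real (card E) / real (card V)"
proof (cases "card W2 \<le> card W1")
  case True
  then show ?thesis using assms by (intro rebalance_aux) auto
next
  case False
  then show ?thesis using assms by (intro rebalance_aux[of V E W2 W1]) auto
qed

text \<open>The indicator of \<open>s u = t\<close> is \<open>(1 + t * s u) / 2\<close>. Multiplying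
  two of these and summing against \<open>adj\<close> yields a constant, a linear and a quadratic
  part, of which only the linear part depends on \<open>t\<close>. The factor 8 is 4 from the halves
  times 2 from ordered pairs.\<close>

lemma edges_inside_signs:
  fixes s :: "'a \<Rightarrow> real"
  assumes G: "simple_graph V E" and s: "\<And>u. u \<in> V \<Longrightarrow> s u = 1 \<or> s u = -1" and t: "t = 1 \<or> t = -1"
  shows "8 * real (edges_inside E {u\<in>V. s u = t}) = 2 * real (card E)
    + 2 * t * (\<Sum>u\<in>V. s u * real (vertex_degree E u))
    + (\<Sum>u\<in>V. \<Sum>v\<in>V. adj E u v * (s u * s v))"
proof -
  have fin: "finite V" using simple_graph_finite[OF G] by auto
  have ind: "(\<Sum>u\<in>{u\<in>V. s u = t}. \<phi> u) = (\<Sum>u\<in>V. (1 + t * s u) / 2 * \<phi> u)" for \<phi>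
  proof -
    have "(if s u = t then \<phi> u else 0) = (1 + t * s u) / 2 * \<phi> u" if "u \<in> V" for u
      using s[OF that] t by auto
    then have "(\<Sum>u\<in>V. if s u = t then \<phi> u else 0) = (\<Sum>u\<in>V. (1 + t * s u) / 2 * \<phi> u)"
      by (intro sum.cong refl)
    then show ?thesis using fin by (simp add: sum.inter_filter)
  qed
  have "8 * real (edges_inside E {u\<in>V. s u = t})
      = 4 * (\<Sum>u\<in>{u\<in>V. s u = t}. \<Sum>v\<in>{u\<in>V. s u = t}. adj E u v)"
    using double_sum_adj[OF G, of "{u\<in>V. s u = t}"] by simp
  also have "\<dots> = (\<Sum>u\<in>V. \<Sum>v\<in>V. (1 + t * s u) * (1 + t * s v) * adj E u v)"
    unfolding ind sum_distrib_left by (intro sum.cong refl) simp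
  also have "\<dots> = (\<Sum>u\<in>V. \<Sum>v\<in>V. adj E u v + t * (s u * adj E u v) + t * (s v * adj E v u)
      + adj E u v * (s u * s v))"
    using t by (intro sum.cong refl) (auto simp: algebra_simps adj_commute)
  also have "\<dots> = (\<Sum>u\<in>V. \<Sum>v\<in>V. adj E u v) + (\<Sum>u\<in>V. \<Sum>v\<in>V. t * (s u * adj E u v))
      + (\<Sum>v\<in>V. \<Sum>u\<in>V. t * (s v * adj E v u)) + (\<Sum>u\<in>V. \<Sum>v\<in>V. adj E u v * (s u * s v))"
    by (simp only: sum.distrib sum.swap[of "\<lambda>u v. t * (s v * adj E v u)"])
  finally show ?thesis
    by (simp add: double_sum_adj_all[OF G] vertex_degree_eq_sum[OF G] sum_distrib_left mult.assoc)
qed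

lemma card_diff_signs:
  fixes s :: "'a \<Rightarrow> real"
  assumes "finite V" and s: "\<And>u. u \<in> V \<Longrightarrow> s u = 1 \<or> s u = -1"
  shows "real (card {u\<in>V. s u = 1}) - real (card {u\<in>V. s u = -1}) = (\<Sum>u\<in>V. s u)"
proof -
  have "real (card {u\<in>V. s u = 1}) - real (card {u\<in>V. s u = -1})
      = (\<Sum>u\<in>V. of_bool (s u = 1) - of_bool (s u = -1))"
    using assms(1) by (simp add: sum_subtractf Collect_conj_eq Int_commute)
  also have "\<dots> = (\<Sum>u\<in>V. s u)"
    using s by (intro sum.cong) fastforce+
  finally show ?thesis .
qed

text \<open>Here \<open>f\<close> prescribes the signs inside each group up to one flip per group.
  The form given by \<open>adj\<close>, plus \<open>m / \<delta>\<close> times the squares of the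
  two normalised linear forms over \<open>B\<close>, goes through a single first moment bound. Light
  groups make the same-group part of the squares small.\<close>

lemma exists_signs:
  fixes f :: "'a \<Rightarrow> real" and g :: "'a \<Rightarrow> 'b" and \<delta> m n :: real
  defines "h \<equiv> \<lambda>E u. real (vertex_degree E u) / (2 * m) + 1 / n"
  assumes G: "simple_graph V E" and "B \<subseteq> V"
    and m: "m = real (card E)" "m > 0" and n: "n = real (card V)" "n > 0"
    and \<delta>: "0 < \<delta>" "\<delta> \<le> 1"
    and f: "\<And>u. f u = 1 \<or> f u = -1"
    and small: "\<And>u. u \<in> B \<Longrightarrow> (\<Sum>v\<in>{v\<in>B. g v = g u}. h E v) \<le> \<delta>\<^sup>2"
  obtains s where "\<And>u. s u = 1 \<or> s u = -1" "\<And>u v. g u = g v \<Longrightarrow> s u * s v = f u * f v"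
    "(\<Sum>u\<in>V. \<Sum>v\<in>V. adj E u v * (s u * s v))
       \<le> (\<Sum>u\<in>V. \<Sum>v\<in>{v\<in>V. g v = g u}. adj E u v * (f u * f v)) + 2 * \<delta> * m"
    "(\<Sum>u\<in>B. s u)\<^sup>2 \<le> 6 * \<delta> * n\<^sup>2"
    "(\<Sum>u\<in>B. s u * real (vertex_degree E u))\<^sup>2 \<le> 6 * \<delta> * (2 * m)\<^sup>2"
proof -
  have fin: "finite V" "finite B" using simple_graph_finite[OF G] \<open>B \<subseteq> V\<close> finite_subset by auto
  define d where "d u = real (vertex_degree E u)" for u
  \<comment> \<open>The indicator of \<open>B\<close> confines the added squares to \<open>B\<close>
    while \<open>adj\<close> is still summed over all of \<open>V\<close>, so one weight function
    can carry both.\<close>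
  define b where "b u = (of_bool (u \<in> B) :: real)" for u
  \<comment> \<open>The kernel of the sum of the two squares. It is dominated by
    \<open>H u * H v\<close>, so a group contributes at most the square of its total weight.\<close>
  define r where "r u v = 1 / n\<^sup>2 + d u * d v / (2 * m)\<^sup>2" for u v
  have d0: "d u \<ge> 0" for u by (simp add: d_def)
  define H where "H u = d u / (2 * m) + 1 / n" for u
  have H0: "H u \<ge> 0" for u using m n d0 by (simp add: H_def)
  have r0: "r u v \<ge> 0" for u v using d0 by (simp add: r_def)
  have rH: "r u v \<le> H u * H v" for u v
  proof -
    have "H u * H v = r u v + (d u / (2 * m) * (1 / n) + d v / (2 * m) * (1 / n))"
      by (simp add: H_def r_def power2_eq_square algebra_simps)
    moreover have "0 \<le> d u / (2 * m) * (1 / n) + d v / (2 * m) * (1 / n)"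
      using m n d0 by simp
    ultimately show ?thesis by linarith
  qed
  \<comment> \<open>The factor \<open>m / \<delta>\<close> serves two purposes: the same-group
    error, of order \<open>\<delta>\<^sup>2\<close>, becomes \<open>2 * \<delta> * m\<close>, and a
    form of size O(m) bounds the squares by O(\<delta>).\<close>
  define w where "w u v = (adj E u v + m / \<delta> * (b u * b v * r u v)) * (f u * f v)" for u v
  obtain \<sigma> :: "'b \<Rightarrow> real" where \<sigma>: "\<forall>i. \<sigma> i = 1 \<or> \<sigma> i = -1"
    and le: "(\<Sum>u\<in>V. \<Sum>v\<in>V. w u v * (\<sigma> (g u) * \<sigma> (g v)))
      \<le> (\<Sum>u\<in>V. \<Sum>v\<in>{v\<in>V. g v = g u}. w u v)"
    using signs_quadratic_grouped[OF fin(1), of w g] by blast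
  define s where "s u = f u * \<sigma> (g u)" for u
  have s: "s u = 1 \<or> s u = -1" for u using f[of u] \<sigma> by (auto simp: s_def)
  have sg: "s u * s v = f u * f v" if "g u = g v" for u v
  proof -
    have "\<sigma> (g v) * \<sigma> (g v) = 1" using \<sigma> by (metis mult_1 mult_minus1 minus_minus)
    then show ?thesis using that by (simp add: s_def)
  qed
  define L1 where "L1 = (\<Sum>u\<in>B. s u)"
  define L2 where "L2 = (\<Sum>u\<in>B. s u * d u)"
  define R where "R = (\<Sum>u\<in>V. \<Sum>v\<in>V. adj E u v * (s u * s v))"
  define R0 where "R0 = (\<Sum>u\<in>V. \<Sum>v\<in>{v\<in>V. g v = g u}. adj E u v * (f u * f v))"
  have restrict: "(\<Sum>u\<in>V. b u * \<phi> u) = (\<Sum>u\<in>B. \<phi> u)" for \<phi> :: "'a \<Rightarrow> real"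
    unfolding b_def using fin \<open>B \<subseteq> V\<close> by (simp add: of_bool_def if_distrib[of "\<lambda>x. x * _"] Int_absorb1 flip: sum.inter_restrict cong: if_cong)
  have sq: "(\<Sum>u\<in>B. \<Sum>v\<in>B. r u v * (s u * s v)) = (L1 / n)\<^sup>2 + (L2 / (2 * m))\<^sup>2"
    unfolding L1_def L2_def power_divide power2_eq_square[of "sum _ _"] sum_product
      sum_divide_distrib sum.distrib[symmetric]
    by (intro sum.cong refl) (simp add: r_def power2_eq_square algebra_simps)
  have lhs: "(\<Sum>u\<in>V. \<Sum>v\<in>V. w u v * (\<sigma> (g u) * \<sigma> (g v)))
      = R + m / \<delta> * ((L1 / n)\<^sup>2 + (L2 / (2 * m))\<^sup>2)"
  proof -
    have "(\<Sum>u\<in>V. \<Sum>v\<in>V. w u v * (\<sigma> (g u) * \<sigma> (g v)))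
        = (\<Sum>u\<in>V. \<Sum>v\<in>V. adj E u v * (s u * s v) + m / \<delta> * (b u * (b v * (r u v * (s u * s v)))))"
      by (intro sum.cong refl) (simp add: w_def s_def algebra_simps)
    also have "\<dots> = R + m / \<delta> * (\<Sum>u\<in>V. b u * (\<Sum>v\<in>V. b v * (r u v * (s u * s v))))"
      by (simp only: sum.distrib R_def sum_distrib_left)
    finally show ?thesis by (simp only: restrict sq)
  qed
  have "(\<Sum>u\<in>V. \<Sum>v\<in>{v\<in>V. g v = g u}. w u v)
      = R0 + m / \<delta> * (\<Sum>u\<in>V. b u * (\<Sum>v\<in>{v\<in>V. g v = g u}. b v * (r u v * (f u * f v))))"
    unfolding R0_def sum_distrib_left sum.distrib[symmetric]
    by (intro sum.cong refl) (simp add: w_def algebra_simps)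
  also have "(\<Sum>u\<in>V. b u * (\<Sum>v\<in>{v\<in>V. g v = g u}. b v * (r u v * (f u * f v))))
      = (\<Sum>u\<in>B. \<Sum>v\<in>{v\<in>V. g v = g u}. b v * (r u v * (f u * f v)))"
    by (rule restrict)
  also have "\<dots> = (\<Sum>u\<in>B. \<Sum>v\<in>{v\<in>B. g v = g u}. r u v * (f u * f v))"
    unfolding b_def using fin \<open>B \<subseteq> V\<close>
    by (intro sum.cong refl sum.mono_neutral_cong_right) auto
  also have "\<dots> \<le> (\<Sum>u\<in>B. \<Sum>v\<in>{v\<in>B. g v = g u}. H u * H v)"
  proof (intro sum_mono)
    fix u v
    have "f u * f v \<le> 1" using f[of u] f[of v] by auto
    then have "r u v * (f u * f v) \<le> r u v * 1" by (rule mult_left_mono[OF _ r0])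
    then show "r u v * (f u * f v) \<le> H u * H v" using rH[of u v] by linarith
  qed
  also have "\<dots> = (\<Sum>u\<in>B. H u * (\<Sum>v\<in>{v\<in>B. g v = g u}. H v))"
    by (simp add: sum_distrib_left)
  also have "\<dots> \<le> (\<Sum>u\<in>B. H u * \<delta>\<^sup>2)"
    using small H0 by (intro sum_mono mult_left_mono) (auto simp: H_def h_def d_def)
  also have "\<dots> \<le> (\<Sum>u\<in>V. H u * \<delta>\<^sup>2)"
    using fin \<open>B \<subseteq> V\<close> H0 by (intro sum_mono2) auto
  also have "\<dots> = 2 * \<delta>\<^sup>2"
  proof -
    have "(\<Sum>u\<in>V. H u) = (\<Sum>u\<in>V. d u) / (2 * m) + 1"
      using n by (simp add: H_def sum.distrib sum_divide_distrib)
    also have "\<dots> = 2" using m by (simp add: d_def sum_vertex_degree[OF G])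
    finally show ?thesis by (simp add: sum_distrib_right[symmetric])
  qed
  finally have "(\<Sum>u\<in>V. \<Sum>v\<in>{v\<in>V. g v = g u}. w u v) \<le> R0 + m / \<delta> * (2 * \<delta>\<^sup>2)"
    using m \<delta> by (simp add: mult_left_mono divide_right_mono)
  also have "m / \<delta> * (2 * \<delta>\<^sup>2) = 2 * \<delta> * m" using \<delta> by (simp add: power2_eq_square)
  finally have main: "R + m / \<delta> * ((L1 / n)\<^sup>2 + (L2 / (2 * m))\<^sup>2) \<le> R0 + 2 * \<delta> * m"
    using le lhs by linarith
  \<comment> \<open>The trivial bounds on \<open>R\<close> and \<open>R0\<close> turn
    \<open>main\<close> into an upper bound on the squares.\<close>
  have Rge: "R \<ge> - (2 * m)"
  proof -
    have "- (2 * m) = (\<Sum>u\<in>V. \<Sum>v\<in>V. - adj E u v)"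
      using double_sum_adj_all[OF G] m by (simp add: sum_negf)
    also have "\<dots> \<le> R" unfolding R_def
    proof (intro sum_mono)
      fix u v show "- adj E u v \<le> adj E u v * (s u * s v)"
        using s[of u] s[of v] adj_nonneg[of E u v] by auto
    qed
    finally show ?thesis .
  qed
  have R0le: "R0 \<le> 2 * m"
  proof -
    have "R0 \<le> (\<Sum>u\<in>V. \<Sum>v\<in>{v\<in>V. g v = g u}. adj E u v)" unfolding R0_def
    proof (intro sum_mono)
      fix u v show "adj E u v * (f u * f v) \<le> adj E u v"
        using f[of u] f[of v] adj_nonneg[of E u v] by auto
    qed
    also have "\<dots> \<le> (\<Sum>u\<in>V. \<Sum>v\<in>V. adj E u v)"
      using fin by (intro sum_mono sum_mono2) (auto simp: adj_nonneg)
    finally show ?thesis using double_sum_adj_all[OF G] m by simp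
  qed
  have "m / \<delta> * ((L1 / n)\<^sup>2 + (L2 / (2 * m))\<^sup>2) \<le> 2 * m + 2 * \<delta> * m + 2 * m"
    using main Rge R0le by linarith
  also have "\<dots> \<le> 6 * m" using \<delta> m by (simp add: mult_left_le_one_le)
  finally have "m * ((L1 / n)\<^sup>2 + (L2 / (2 * m))\<^sup>2) \<le> m * (6 * \<delta>)"
    using \<delta> by (simp add: pos_divide_le_eq mult.assoc)
  then have bnd: "(L1 / n)\<^sup>2 + (L2 / (2 * m))\<^sup>2 \<le> 6 * \<delta>"
    using m(2) by (rule mult_left_le_imp_le)
  have "(L1 / n)\<^sup>2 \<le> 6 * \<delta>" "(L2 / (2 * m))\<^sup>2 \<le> 6 * \<delta>"
    using bnd zero_le_power2[of "L1 / n"] zero_le_power2[of "L2 / (2 * m)"] by linarith+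
  then have L: "L1\<^sup>2 \<le> 6 * \<delta> * n\<^sup>2" "L2\<^sup>2 \<le> 6 * \<delta> * (2 * m)\<^sup>2"
    using m n by (simp_all add: power_divide pos_divide_le_eq)
  have "0 \<le> m / \<delta> * ((L1 / n)\<^sup>2 + (L2 / (2 * m))\<^sup>2)" using m \<delta> by simp
  then have "R \<le> R0 + 2 * \<delta> * m" using main by linarith
  with L that[of s] s sg show thesis by (simp add: R_def R0_def L1_def L2_def d_def)
qed

section \<open>Groups formed by stars\<close>

text \<open>Each centre is opposite to all its leaves, so every edge from centre to leaf is cut.
  Where \<open>c\<close> is unspecified the value is arbitrary but still a sign.\<close>

definition centre_sign :: "('a \<Rightarrow> 'a) \<Rightarrow> 'a \<Rightarrow> real" where
  "centre_sign c u = (if c u = u then 1 else -1)"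

text \<open>With \<open>k\<close> leaves, the centre gives \<open>2 * k\<close> adjacent ordered
  pairs of sign product -1, and the leaves give \<open>X\<close> pairs of product 1. As
  \<open>X\<close> is at most \<open>2 * (k - 1)\<close>, \<open>X - 2 * k\<close> is negative and
  \<open>2 * X - 8 * k\<close> is at most \<open>- 4 * (k + 1)\<close>, where \<open>k + 1\<close>
  is the size of the star.\<close>

lemma star_fibre_sums:
  fixes c :: "'a \<Rightarrow> 'a" and z :: 'a and B :: "'a set"
  defines "f \<equiv> centre_sign c" and "S \<equiv> {u\<in>B. c u = z}"
  assumes c: "star_map E B c" and fin: "finite B" and loopfree: "\<And>u. {u} \<notin> E" and z: "z \<in> B" "c z = z"
  shows "(\<Sum>u\<in>S. \<Sum>v\<in>S. adj E u v * (f u * f v)) \<le> 0"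
    and "(\<Sum>u\<in>S. \<Sum>v\<in>S. adj E u v * (3 * (f u * f v) - 1)) \<le> - 4 * real (card S)"
proof -
  define F where "F = {u\<in>B - {z}. c u = z}"
  define X where "X = (\<Sum>u\<in>F. \<Sum>v\<in>F. adj E u v)"
  have S: "S = insert z F" and zF: "z \<notin> F" and finF: "finite F"
    using z fin by (auto simp: S_def F_def)
  have X: "X \<le> 2 * (real (card F) - 1)"
    using c z unfolding star_map_def X_def F_def by blast
  have fF: "f u = -1" if "u \<in> F" for u
    using z that by (auto simp: f_def centre_sign_def F_def)
  have leaf: "{u, z} \<in> E" if "u \<in> F" for u
    using c that unfolding star_map_def F_def by fastforce
  then have leaf': "{z, u} \<in> E" if "u \<in> F" for u
    using that by (simp add: insert_commute)
  have gen: "(\<Sum>u\<in>S. \<Sum>v\<in>S. adj E u v * (\<alpha> * (f u * f v) - \<beta>)) = (\<alpha> - \<beta>) * X - 2 * real (card F) * (\<alpha> + \<beta>)"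
    for \<alpha> \<beta> :: real
  proof -
    have "(\<Sum>u\<in>S. \<Sum>v\<in>S. adj E u v * (\<alpha> * (f u * f v) - \<beta>))
        = adj E z z * (\<alpha> * (f z * f z) - \<beta>) + (\<Sum>v\<in>F. adj E z v * (\<alpha> * (f z * f v) - \<beta>))
        + ((\<Sum>u\<in>F. adj E u z * (\<alpha> * (f u * f z) - \<beta>))
        + (\<Sum>u\<in>F. \<Sum>v\<in>F. adj E u v * (\<alpha> * (f u * f v) - \<beta>)))"
      unfolding S using zF finF by (simp add: sum.distrib)
    also have "adj E z z = 0" using loopfree by (simp add: adj_def)
    also have "(\<Sum>v\<in>F. adj E z v * (\<alpha> * (f z * f v) - \<beta>)) = (\<Sum>v\<in>F. - (\<alpha> + \<beta>))"
      using z(2) leaf' fF by (intro sum.cong refl) (simp add: adj_def f_def centre_sign_def)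
    also have "(\<Sum>u\<in>F. adj E u z * (\<alpha> * (f u * f z) - \<beta>)) = (\<Sum>v\<in>F. - (\<alpha> + \<beta>))"
      using z(2) leaf fF by (intro sum.cong refl) (simp add: adj_def f_def centre_sign_def)
    also have "(\<Sum>u\<in>F. \<Sum>v\<in>F. adj E u v * (\<alpha> * (f u * f v) - \<beta>)) = (\<alpha> - \<beta>) * X"
      unfolding X_def sum_distrib_left using fF by (intro sum.cong refl) simp
    finally show ?thesis by (simp add: algebra_simps)
  qed
  show "(\<Sum>u\<in>S. \<Sum>v\<in>S. adj E u v * (f u * f v)) \<le> 0"
    using gen[of 1 0] X by simp
  have "card S = card F + 1" using S zF finF by simp
  then show "(\<Sum>u\<in>S. \<Sum>v\<in>S. adj E u v * (3 * (f u * f v) - 1)) \<le> - 4 * real (card S)"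
    using gen[of 3 1] X by simp
qed

text \<open>\<open>H\<close> is a union of stars; the remaining vertices form groups of their own.\<close>

definition star_group :: "('a \<Rightarrow> 'a) \<Rightarrow> 'a set \<Rightarrow> 'a \<Rightarrow> 'a" where
  "star_group c H u = (if u \<in> H then c u else u)"

text \<open>Being closed under the fibres of \<open>c\<close>, \<open>H\<close> contains the centres
  of its stars; hence the label of such a star never equals a vertex outside
  \<open>H\<close>.\<close>

lemma star_group_fibre:
  assumes c: "star_map E B' c" and B: "B' \<subseteq> B"
    and H: "H \<subseteq> B'" "\<And>u v. u \<in> H \<Longrightarrow> v \<in> B' \<Longrightarrow> c v = c u \<Longrightarrow> v \<in> H"
    and "u \<in> B"
  shows "{v\<in>B. star_group c H v = star_group c H u} = (if u \<in> H then {v\<in>B'. c v = c u} else {u})"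
proof -
  have cB: "c u \<in> B'" "c (c u) = c u" if "u \<in> B'" for u
    using c that by (auto simp: star_map_def)
  have cH: "c u \<in> H" if "u \<in> H" for u
  proof -
    have "u \<in> B'" using that H(1) by blast
    then show ?thesis using H(2)[OF that cB(1) cB(2)] by blast
  qed
  show ?thesis
  proof (cases "u \<in> H")
    case True
    have "v \<in> B' \<and> c v = c u" if "v \<in> B" "star_group c H v = c u" for v
    proof (cases "v \<in> H")
      case True
      then show ?thesis using that H(1) by (auto simp: star_group_def)
    next
      case False
      then have "v = c u" using that by (simp add: star_group_def)
      then show ?thesis using False cH[OF \<open>u \<in> H\<close>] by simp
    qed
    moreover have "v \<in> B \<and> star_group c H v = c u" if "v \<in> B'" "c v = c u" for v
      using that(2) H(2)[OF True that] subsetD[OF B that(1)] by (simp add: star_group_def)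
    ultimately have "{v\<in>B. star_group c H v = c u} = {v\<in>B'. c v = c u}"
      by (intro Collect_cong iffI) blast+
    then show ?thesis using True by (simp add: star_group_def)
  next
    case False
    have "v = u" if "star_group c H v = u" for v
    proof (cases "v \<in> H")
      case True
      then show ?thesis using cH[OF True] that False by (simp add: star_group_def)
    qed (use that in \<open>simp add: star_group_def\<close>)
    moreover have "star_group c H u = u" using False by (simp add: star_group_def)
    ultimately have "{v\<in>B. star_group c H v = u} = {u}" using \<open>u \<in> B\<close> by blast
    then show ?thesis using False by (simp add: star_group_def)
  qed
qed

text \<open>Groups outside \<open>H\<close> are single vertices and contribute nothing, as there are
  no loops. Both bounds are sums of the bounds for single stars; for the second, the edges inside
  groups are then estimated by all edges inside \<open>B\<close>.\<close>

lemma star_groups_sums: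
  fixes c :: "'a \<Rightarrow> 'a"
  defines "f \<equiv> centre_sign c" and "g \<equiv> star_group c"
  assumes c: "star_map E B' c" and B: "B' \<subseteq> B" "finite B" and loopfree: "\<And>u. {u} \<notin> E"
    and H: "H \<subseteq> B'" "\<And>u v. u \<in> H \<Longrightarrow> v \<in> B' \<Longrightarrow> c v = c u \<Longrightarrow> v \<in> H"
  shows "(\<Sum>u\<in>B. \<Sum>v\<in>{v\<in>B. g H v = g H u}. adj E u v * (f u * f v)) \<le> 0"
    and "3 * (\<Sum>u\<in>B. \<Sum>v\<in>{v\<in>B. g H v = g H u}. adj E u v * (f u * f v))
      \<le> (\<Sum>u\<in>B. \<Sum>v\<in>B. adj E u v) - 4 * real (card H)"
proof -
  have fin: "finite B" "finite B'" "finite H"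
    using finite_subset[OF B] finite_subset[OF subset_trans[OF H(1) B(1)] B(2)] B(2) by auto
  have cB: "c u \<in> B'" "c (c u) = c u" if "u \<in> B'" for u
    using c that by (auto simp: star_map_def)
  have loop: "adj E u u = 0" for u using loopfree by (simp add: adj_def)
  have split: "(\<Sum>u\<in>B. \<Sum>v\<in>{v\<in>B. g H v = g H u}. adj E u v * \<phi> u v)
      = (\<Sum>z\<in>c ` H. \<Sum>u\<in>{u\<in>B'. c u = z}. \<Sum>v\<in>{v\<in>B'. c v = z}. adj E u v * \<phi> u v)" for \<phi>
  proof -
    have "(\<Sum>u\<in>B. \<Sum>v\<in>{v\<in>B. g H v = g H u}. adj E u v * \<phi> u v)
        = (\<Sum>u\<in>B. if u \<in> H then (\<Sum>v\<in>{v\<in>B'. c v = c u}. adj E u v * \<phi> u v) else 0)"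
      by (intro sum.cong refl) (simp add: g_def star_group_fibre[OF c B(1) H] loop)
    also have "\<dots> = (\<Sum>u\<in>H. \<Sum>v\<in>{v\<in>B'. c v = c u}. adj E u v * \<phi> u v)"
      using fin B H by (simp add: sum.If_cases Int_absorb1)
    also have "\<dots> = (\<Sum>z\<in>c ` H. \<Sum>u\<in>{u\<in>H. c u = z}. \<Sum>v\<in>{v\<in>B'. c v = c u}. adj E u v * \<phi> u v)"
      by (rule sum.image_gen[OF fin(3)])
    also have "\<dots> = (\<Sum>z\<in>c ` H. \<Sum>u\<in>{u\<in>B'. c u = z}. \<Sum>v\<in>{v\<in>B'. c v = z}. adj E u v * \<phi> u v)"
      using H by (intro sum.cong) auto
    finally show ?thesis .
  qed
  have zc: "z \<in> B' \<and> c z = z" if zH: "z \<in> c ` H" for z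
  proof -
    obtain u where u: "u \<in> H" "z = c u" using zH by blast
    then have "u \<in> B'" using H(1) by blast
    from cB[OF this] show ?thesis unfolding u(2) by blast
  qed
  have fibre:
    "(\<Sum>u\<in>{u\<in>B'. c u = z}. \<Sum>v\<in>{v\<in>B'. c v = z}. adj E u v * (f u * f v)) \<le> 0"
    "(\<Sum>u\<in>{u\<in>B'. c u = z}. \<Sum>v\<in>{v\<in>B'. c v = z}. adj E u v * (3 * (f u * f v) - 1))
      \<le> - 4 * real (card {u\<in>B'. c u = z})"
    if "z \<in> c ` H" for z
    unfolding f_def using zc[OF that]
    by (blast intro: star_fibre_sums[OF c fin(2) loopfree])+
  show "(\<Sum>u\<in>B. \<Sum>v\<in>{v\<in>B. g H v = g H u}. adj E u v * (f u * f v)) \<le> 0"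
    unfolding split by (intro sum_nonpos fibre(1))
  have "(\<Sum>u\<in>B. \<Sum>v\<in>{v\<in>B. g H v = g H u}. adj E u v * (3 * (f u * f v) - 1))
      \<le> (\<Sum>z\<in>c ` H. - 4 * real (card {u\<in>B'. c u = z}))"
    unfolding split by (intro sum_mono fibre(2))
  also have "\<dots> = (\<Sum>z\<in>c ` H. \<Sum>u\<in>{u\<in>H. c u = z}. - 4)"
  proof (intro sum.cong refl)
    fix z assume "z \<in> c ` H"
    then have "{u\<in>B'. c u = z} = {u\<in>H. c u = z}" using H by auto
    then show "- 4 * real (card {u\<in>B'. c u = z}) = (\<Sum>u\<in>{u\<in>H. c u = z}. - 4)" by simp
  qed
  also have "\<dots> = (\<Sum>u\<in>H. - 4)" by (rule sum.image_gen[OF fin(3), symmetric])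
  finally have 1: "(\<Sum>u\<in>B. \<Sum>v\<in>{v\<in>B. g H v = g H u}. adj E u v * (3 * (f u * f v) - 1)) \<le> - 4 * real (card H)"
    by simp
  have "(\<Sum>u\<in>B. \<Sum>v\<in>{v\<in>B. g H v = g H u}. adj E u v * (3 * (f u * f v) - 1))
      = 3 * (\<Sum>u\<in>B. \<Sum>v\<in>{v\<in>B. g H v = g H u}. adj E u v * (f u * f v))
      - (\<Sum>u\<in>B. \<Sum>v\<in>{v\<in>B. g H v = g H u}. adj E u v)"
    unfolding sum_distrib_left sum_subtractf[symmetric] by (intro sum.cong refl) (simp add: algebra_simps)
  moreover have "(\<Sum>u\<in>B. \<Sum>v\<in>{v\<in>B. g H v = g H u}. adj E u v) \<le> (\<Sum>u\<in>B. \<Sum>v\<in>B. adj E u v)"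
    using fin by (intro sum_mono sum_mono2) (auto simp: adj_nonneg)
  ultimately show "3 * (\<Sum>u\<in>B. \<Sum>v\<in>{v\<in>B. g H v = g H u}. adj E u v * (f u * f v))
      \<le> (\<Sum>u\<in>B. \<Sum>v\<in>B. adj E u v) - 4 * real (card H)"
    using 1 by linarith
qed

lemma star_card_le:
  assumes G: "simple_graph V E" and c: "star_map E B c" and B: "B \<subseteq> V" and z: "z \<in> B"
  shows "card {u\<in>B. c u = z} \<le> 1 + vertex_degree E z"
proof -
  have fin: "finite V" "finite E" using simple_graph_finite[OF G] by auto
  have "(\<lambda>u. {u, z}) ` ({u\<in>B. c u = z} - {z}) \<subseteq> {e\<in>E. z \<in> e}"
    using c by (auto simp: star_map_def)
  then have "card ((\<lambda>u. {u, z}) ` ({u\<in>B. c u = z} - {z})) \<le> vertex_degree E z"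
    unfolding vertex_degree_def using fin by (intro card_mono) auto
  moreover have "inj_on (\<lambda>u. {u, z}) ({u\<in>B. c u = z} - {z})"
    by (auto simp: inj_on_def doubleton_eq_iff)
  ultimately have "card ({u\<in>B. c u = z} - {z}) \<le> vertex_degree E z" by (simp add: card_image)
  moreover have "card {u\<in>B. c u = z} - card {z} \<le> card ({u\<in>B. c u = z} - {z})"
    by (rule diff_card_le_card_Diff) simp
  ultimately show ?thesis by auto
qed

text \<open>A Markov-type estimate: in a fibre of weight above \<open>\<kappa>\<close> and size at
  most \<open>k\<close>, \<open>\<kappa>\<close> times the size is at most \<open>k\<close> times
  the weight. It limits the vertices lost when heavy stars are broken up.\<close>

lemma heavy_fibres_card_le:
  fixes h :: "'a \<Rightarrow> real" and \<kappa> :: real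
  assumes fin: "finite B" and h: "\<And>u. u \<in> B \<Longrightarrow> h u \<ge> 0"
    and k: "\<And>u. u \<in> B \<Longrightarrow> real (card {v\<in>B. c v = c u}) \<le> k" "k \<ge> 0"
  shows "\<kappa> * real (card {u\<in>B. (\<Sum>v\<in>{v\<in>B. c v = c u}. h v) > \<kappa>}) \<le> k * (\<Sum>u\<in>B. h u)"
proof -
  define L where "L = {u\<in>B. (\<Sum>v\<in>{v\<in>B. c v = c u}. h v) > \<kappa>}"
  have finL: "finite L" using fin by (simp add: L_def)
  have L: "{u\<in>L. c u = z} = {u\<in>B. c u = z}" "(\<Sum>v\<in>{v\<in>B. c v = z}. h v) > \<kappa>"
    if "z \<in> c ` L" for z using that by (auto simp: L_def)
  have "\<kappa> * real (card L) = (\<Sum>z\<in>c ` L. \<Sum>u\<in>{u\<in>L. c u = z}. \<kappa>)"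
    using sum.image_gen[OF finL, of "\<lambda>_. \<kappa>" c] by (simp add: mult.commute)
  also have "\<dots> = (\<Sum>z\<in>c ` L. \<kappa> * real (card {u\<in>B. c u = z}))"
    by (intro sum.cong refl) (simp add: L(1))
  also have "\<dots> \<le> (\<Sum>z\<in>c ` L. k * (\<Sum>v\<in>{v\<in>L. c v = z}. h v))"
  proof (intro sum_mono)
    fix z assume z: "z \<in> c ` L"
    then have "real (card {u\<in>B. c u = z}) \<le> k" using k by (auto simp: L_def)
    have "\<kappa> * real (card {u\<in>B. c u = z}) \<le> (\<Sum>v\<in>{v\<in>B. c v = z}. h v) * real (card {u\<in>B. c u = z})"
      using L(2)[OF z] by (intro mult_right_mono) auto
    also have "\<dots> \<le> (\<Sum>v\<in>{v\<in>B. c v = z}. h v) * k"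
      using \<open>real (card {u\<in>B. c u = z}) \<le> k\<close> h by (intro mult_left_mono sum_nonneg) auto
    finally show "\<kappa> * real (card {u\<in>B. c u = z}) \<le> k * (\<Sum>v\<in>{v\<in>L. c v = z}. h v)"
      by (simp add: L(1)[OF z] mult.commute)
  qed
  also have "\<dots> = k * (\<Sum>u\<in>L. h u)"
    unfolding sum_distrib_left[symmetric] by (simp only: sum.image_gen[OF finL, of h c])
  also have "\<dots> \<le> k * (\<Sum>u\<in>B. h u)"
    using fin h k(2) by (intro mult_left_mono sum_mono2) (auto simp: L_def)
  finally show ?thesis by (simp add: L_def)
qed

section \<open>Near-bisections\<close>

text \<open>Neighbours of \<open>v\<close> in \<open>A\<close> and non-isolated neighbours in
  \<open>B\<close> are counted trivially. Any other neighbour has, by the degree condition, a second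
  neighbour in \<open>A\<close>, and is charged to the degree of that vertex.\<close>

lemma degree_le_nonisolated:
  assumes G: "simple_graph V E" and deg: "\<And>u. u \<in> V \<Longrightarrow> 2 \<le> vertex_degree E u"
    and A: "A \<subseteq> V" "v \<in> A"
  defines "B \<equiv> V - A"
  shows "real (vertex_degree E v) \<le> real (card A) + real (card {u\<in>B. \<exists>w\<in>B. {u, w} \<in> E})
    + (\<Sum>w\<in>A - {v}. real (vertex_degree E w))"
proof -
  define B' where "B' = {u\<in>B. \<exists>w\<in>B. {u, w} \<in> E}"
  have fin: "finite V" "finite A" "finite B" "finite B'"
    using simple_graph_finite[OF G] A finite_subset by (auto simp: B_def B'_def)
  have nonadj: "adj E u w = 0" if "u \<in> B - B'" "w \<in> B" for u w
    using that by (auto simp: adj_def B'_def)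
  \<comment> \<open>A vertex all of whose neighbours lie in \<open>A\<close> has a neighbour in \<open>A\<close> other than \<open>v\<close>.\<close>
  have key: "adj E v u \<le> (\<Sum>w\<in>A - {v}. adj E w u)" if u: "u \<in> B - B'" for u
  proof -
    have "2 \<le> real (vertex_degree E u)" using deg[of u] u by (simp add: B_def)
    also have "\<dots> = (\<Sum>w\<in>V - A. adj E u w) + (\<Sum>w\<in>A. adj E u w)"
      unfolding vertex_degree_eq_sum[OF G] by (rule sum.subset_diff[OF A(1) fin(1)])
    also have "(\<Sum>w\<in>V - A. adj E u w) = 0"
      using nonadj[OF u] by (simp add: B_def)
    also have "(\<Sum>w\<in>A. adj E u w) = adj E u v + (\<Sum>w\<in>A - {v}. adj E u w)"
      by (rule sum.remove[OF fin(2) A(2)])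
    also have "\<dots> = adj E v u + (\<Sum>w\<in>A - {v}. adj E w u)"
      by (simp only: adj_commute[of E u])
    finally show ?thesis using adj_le_1[of E v u] by linarith
  qed
  have "real (vertex_degree E v) = (\<Sum>u\<in>B. adj E v u) + (\<Sum>u\<in>A. adj E v u)"
    unfolding vertex_degree_eq_sum[OF G] B_def by (rule sum.subset_diff[OF A(1) fin(1)])
  also have "(\<Sum>u\<in>B. adj E v u) = (\<Sum>u\<in>B - B'. adj E v u) + (\<Sum>u\<in>B'. adj E v u)"
    by (rule sum.subset_diff) (auto simp: B'_def fin)
  also have "(\<Sum>u\<in>A. adj E v u) \<le> real (card A) * 1"
    by (intro sum_bounded_above adj_le_1)
  also have "(\<Sum>u\<in>B'. adj E v u) \<le> real (card B') * 1"
    by (intro sum_bounded_above adj_le_1)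
  also have "(\<Sum>u\<in>B - B'. adj E v u) \<le> (\<Sum>u\<in>B - B'. \<Sum>w\<in>A - {v}. adj E w u)"
    by (intro sum_mono key)
  also have "\<dots> = (\<Sum>w\<in>A - {v}. \<Sum>u\<in>B - B'. adj E w u)" by (rule sum.swap)
  also have "\<dots> \<le> (\<Sum>w\<in>A - {v}. real (vertex_degree E w))"
    unfolding vertex_degree_eq_sum[OF G]
    using fin by (intro sum_mono sum_mono2) (auto simp: adj_nonneg B_def)
  finally show ?thesis by (simp add: B'_def)
qed

text \<open>By \<open>edges_inside_signs\<close> it suffices that the quadratic form plus twice the
  absolute value of the signed degree sum is close to \<open>2 * m / 3\<close>. The other terms are
  errors: \<open>a\<close> counts the vertices of large degree,
  \<open>4 * \<gamma> * m / \<delta>\<^sup>2\<close> the vertices of broken stars, and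
  \<open>r\<close> and \<open>\<delta>\<close> come from the signs.\<close>

lemma near_bisection:
  fixes m n \<delta> r \<gamma> a :: real
  assumes G: "simple_graph V E" and deg: "\<And>u. u \<in> V \<Longrightarrow> 2 \<le> vertex_degree E u"
    and m: "m = real (card E)" "m > 0" and n: "n = real (card V)" "n > 0"
    and \<delta>: "0 < \<delta>" "\<delta> \<le> 1" and r: "0 \<le> r" "6 * \<delta> \<le> r\<^sup>2"
    and \<gamma>: "0 < \<gamma>" "1 \<le> \<gamma> * m" "\<gamma> / 2 + 1 / n \<le> \<delta>\<^sup>2"
    and a: "a = real (card {u\<in>V. \<gamma> * m \<le> real (vertex_degree E u)})"
  shows "\<exists>W1 W2. W1 \<union> W2 = V \<and> W1 \<inter> W2 = {} \<and>
    \<bar>real (card W1) - real (card W2)\<bar> \<le> a + r * n \<and>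
    (\<forall>W\<in>{W1, W2}. 8 * real (edges_inside E W)
      \<le> 8 * m / 3 + 4 / 3 * (a\<^sup>2 + a + 4 * \<gamma> * m / \<delta>\<^sup>2) + 4 * r * m + 2 * \<delta> * m)"
proof -
  define d where "d u = real (vertex_degree E u)" for u
  define A where "A = {u\<in>V. \<gamma> * m \<le> d u}"
  define B where "B = V - A"
  define B' where "B' = {u\<in>B. \<exists>w\<in>B. {u, w} \<in> E}"
  define h where "h u = d u / (2 * m) + 1 / n" for u
  have AV: "A \<subseteq> V" and BV: "B \<subseteq> V" and BB: "B' \<subseteq> B" by (auto simp: A_def B_def B'_def)
  have fin: "finite V" "finite A" "finite B" "finite B'"
    using simple_graph_finite[OF G] by (auto simp: A_def B_def B'_def)
  have a: "a = real (card A)" using a by (simp add: A_def d_def)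
  have loopfree: "\<And>u. {u} \<notin> E" by (rule simple_graph_loopfree[OF G])
  have h0: "h u \<ge> 0" for u using m n by (simp add: h_def d_def)
  have sumd: "(\<Sum>u\<in>V. d u) = 2 * m" using sum_vertex_degree[OF G] m by (simp add: d_def)
  have sumh: "(\<Sum>u\<in>V. h u) = 2"
    using n m sumd by (simp add: h_def sum.distrib sum_divide_distrib[symmetric])
  have splitV: "(\<Sum>u\<in>V. \<phi> u) = (\<Sum>u\<in>B. \<phi> u) + (\<Sum>u\<in>A. \<phi> u)" for \<phi> :: "'a \<Rightarrow> real"
    unfolding B_def by (rule sum.subset_diff[OF AV fin(1)])

  \<comment> \<open>Light stars covering most non-isolated vertices of \<open>B\<close>\<close>
  have "\<exists>v\<in>B'. {u, v} \<in> E" if "u \<in> B'" for u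
  proof -
    obtain w where w: "w \<in> B" "{u, w} \<in> E" using \<open>u \<in> B'\<close> by (auto simp: B'_def)
    then have "{w, u} \<in> E" by (simp add: insert_commute)
    then have "w \<in> B'" using w \<open>u \<in> B'\<close> by (auto simp: B'_def)
    then show ?thesis using w by blast
  qed
  then obtain c where c: "star_map E B' c" using star_map_exists[OF fin(4), of E] loopfree by blast
  have cB: "c u \<in> B'" if "u \<in> B'" for u using c that by (auto simp: star_map_def)
  \<comment> \<open>Stars of large total weight \<open>h\<close> are broken up into single vertices. There are few of them, and
    they have few leaves since their centres have small degree.\<close>
  define H where "H = {u\<in>B'. (\<Sum>v\<in>{v\<in>B'. c v = c u}. h v) \<le> \<delta>\<^sup>2}"
  have H: "H \<subseteq> B'" "\<And>u v. u \<in> H \<Longrightarrow> v \<in> B' \<Longrightarrow> c v = c u \<Longrightarrow> v \<in> H"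
    by (auto simp: H_def)
  define lost where "lost = real (card (B' - H))"
  have cardB': "real (card B') = real (card H) + lost"
    using card_Diff_subset[OF finite_subset[OF H(1) fin(4)] H(1)] card_mono[OF fin(4) H(1)]
    by (simp add: lost_def)
  have "\<delta>\<^sup>2 * lost \<le> 2 * \<gamma> * m * (\<Sum>u\<in>B'. h u)"
  proof -
    have "B' - H = {u\<in>B'. (\<Sum>v\<in>{v\<in>B'. c v = c u}. h v) > \<delta>\<^sup>2}" by (auto simp: H_def)
    \<comment> \<open>The factor 2 absorbs the centre itself, since \<open>\<gamma> * m\<close> is
      at least 1.\<close>
    moreover have "real (card {v\<in>B'. c v = c u}) \<le> 2 * \<gamma> * m" if "u \<in> B'" for u
    proof -
      have "card {v\<in>B'. c v = c u} \<le> 1 + vertex_degree E (c u)"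
        using cB[OF that] BB BV by (intro star_card_le[OF G c]) auto
      then have "real (card {v\<in>B'. c v = c u}) \<le> 1 + d (c u)" unfolding d_def by linarith
      moreover have "d (c u) < \<gamma> * m" using cB[OF that] BB by (auto simp: B_def A_def)
      ultimately show ?thesis using \<gamma> by linarith
    qed
    ultimately show ?thesis
      unfolding lost_def using heavy_fibres_card_le[OF fin(4), of h c "2 * \<gamma> * m" "\<delta>\<^sup>2"] h0 \<gamma> m by simp
  qed
  also have "\<dots> \<le> 2 * \<gamma> * m * (\<Sum>u\<in>V. h u)"
    using fin BB BV h0 \<gamma> m by (intro mult_left_mono sum_mono2) auto
  finally have lost: "lost \<le> 4 * \<gamma> * m / \<delta>\<^sup>2"
    using \<delta> by (simp add: sumh pos_le_divide_eq ac_simps)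

  \<comment> \<open>Splitting the vertices of large degree\<close>
  have dpos: "0 < d u" if "u \<in> A" for u
  proof -
    have "\<gamma> * m \<le> d u" using that by (simp add: A_def)
    then show ?thesis using \<gamma>(2) by linarith
  qed
  from near_balanced_subset[where w = d, OF fin(2) dpos]
  obtain T where T: "T \<subseteq> A" "0 \<le> sum d T - sum d (A - T)"
    and Tcases: "3 * (sum d T - sum d (A - T)) \<le> sum d A \<or> (\<exists>v\<in>A. T = {v})"
    by blast
  define \<theta> where "\<theta> = sum d T - sum d (A - T)"

  \<comment> \<open>Groups and the choice of signs\<close>
  define f where "f u = (if u \<in> A then if u \<in> T then 1 else -1 else centre_sign c u)" for u
  \<comment> \<open>The label \<open>None\<close> makes \<open>A\<close> one group, distinct from
    every star group, so flipping keeps its split up to exchanging the sides.\<close>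
  define g where "g u = (if u \<in> A then None else Some (star_group c H u))" for u
  have f: "f u = 1 \<or> f u = -1" for u by (simp add: f_def centre_sign_def)
  have gA: "{v\<in>V. g v = g u} = A" if "u \<in> A" for u
    using that AV by (auto simp: g_def split: if_splits)
  have gB: "{v\<in>V. g v = g u} = {v\<in>B. star_group c H v = star_group c H u}"
    "{v\<in>B. g v = g u} = {v\<in>B. star_group c H v = star_group c H u}" if "u \<in> B" for u
    using that by (auto simp: g_def B_def split: if_splits)
  have fibre: "{v\<in>B. g v = g u} = (if u \<in> H then {v\<in>B'. c v = c u} else {u})" if "u \<in> B" for u
    unfolding gB(2)[OF that] by (rule star_group_fibre[OF c BB H that])
  have small: "(\<Sum>v\<in>{v\<in>B. g v = g u}. h v) \<le> \<delta>\<^sup>2" if u: "u \<in> B" for u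
  proof (cases "u \<in> H")
    case True
    then show ?thesis unfolding fibre[OF u] by (simp add: H_def)
  next
    case False
    have "d u \<le> \<gamma> * m" using u by (auto simp: B_def A_def)
    then have "d u / (2 * m) \<le> \<gamma> / 2" using m by (simp add: pos_divide_le_eq)
    then have "h u \<le> \<gamma> / 2 + 1 / n" by (simp add: h_def)
    then show ?thesis unfolding fibre[OF u] using False \<gamma>(3) by simp
  qed
  obtain s :: "'a \<Rightarrow> real" where s: "\<And>u. s u = 1 \<or> s u = -1"
    and sg: "\<And>u v. g u = g v \<Longrightarrow> s u * s v = f u * f v"
    and sR: "(\<Sum>u\<in>V. \<Sum>v\<in>V. adj E u v * (s u * s v))
       \<le> (\<Sum>u\<in>V. \<Sum>v\<in>{v\<in>V. g v = g u}. adj E u v * (f u * f v)) + 2 * \<delta> * m"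
    and s1: "(\<Sum>u\<in>B. s u)\<^sup>2 \<le> 6 * \<delta> * n\<^sup>2"
    and s2: "(\<Sum>u\<in>B. s u * real (vertex_degree E u))\<^sup>2 \<le> 6 * \<delta> * (2 * m)\<^sup>2"
  proof (rule exists_signs[where f = f and g = g, OF G BV m n \<delta> f small[unfolded h_def d_def]], goal_cases)
    case (2 s)
    show ?case by (rule that) (fact 2)+
  qed

  \<comment> \<open>Bounds on the linear forms\<close>
  have "(\<Sum>u\<in>B. s u)\<^sup>2 \<le> (r * n)\<^sup>2"
    using s1 mult_right_mono[OF r(2), of "n\<^sup>2"] by (simp add: power_mult_distrib)
  then have L1: "\<bar>\<Sum>u\<in>B. s u\<bar> \<le> r * n"
    using r n abs_le_square_iff[of "\<Sum>u\<in>B. s u" "r * n"] by simp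
  have "(\<Sum>u\<in>B. s u * d u)\<^sup>2 \<le> (r * (2 * m))\<^sup>2"
    using s2 mult_right_mono[OF r(2) zero_le_power2, of "2 * m"]
    unfolding d_def power_mult_distrib[of r] by (rule order_trans)
  then have L2: "\<bar>\<Sum>u\<in>B. s u * d u\<bar> \<le> r * (2 * m)"
    using r m abs_le_square_iff[of "\<Sum>u\<in>B. s u * d u" "r * (2 * m)"] by simp
  have "\<bar>\<Sum>u\<in>A. s u\<bar> \<le> (\<Sum>u\<in>A. \<bar>s u\<bar>)" by (rule sum_abs)
  also have "\<dots> \<le> real (card A) * 1"
  proof (rule sum_bounded_above)
    fix u show "\<bar>s u\<bar> \<le> 1" using s[of u] by auto
  qed
  finally have "\<bar>\<Sum>u\<in>A. s u\<bar> \<le> a" by (simp add: a)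
  then have bal: "\<bar>\<Sum>u\<in>V. s u\<bar> \<le> a + r * n" using L1 splitV[of s] by linarith

  have fT: "(\<Sum>u\<in>A. f u * d u) = \<theta>"
  proof -
    have "(\<Sum>u\<in>A. f u * d u) = (\<Sum>u\<in>A - T. f u * d u) + (\<Sum>u\<in>T. f u * d u)"
      by (rule sum.subset_diff[OF T(1) fin(2)])
    also have "(\<Sum>u\<in>A - T. f u * d u) = - sum d (A - T)"
      by (simp add: f_def sum_negf)
    also have "(\<Sum>u\<in>T. f u * d u) = sum d T"
      using T(1) by (intro sum.cong) (auto simp: f_def)
    finally show ?thesis by (simp add: \<theta>_def)
  qed
  \<comment> \<open>On \<open>A\<close> only products of two signs are known to agree with
    \<open>f\<close>, so the sum is determined up to sign, through its square.\<close>
  have "(\<Sum>u\<in>A. s u * d u)\<^sup>2 = (\<Sum>u\<in>A. \<Sum>v\<in>A. s u * s v * (d u * d v))"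
    unfolding power2_eq_square sum_product by (intro sum.cong refl) (simp add: ac_simps)
  also have "\<dots> = (\<Sum>u\<in>A. \<Sum>v\<in>A. f u * f v * (d u * d v))"
    using sg by (intro sum.cong refl) (simp add: g_def)
  also have "\<dots> = \<theta>\<^sup>2"
    unfolding fT[symmetric] power2_eq_square sum_product by (intro sum.cong refl) (simp add: ac_simps)
  finally have "\<bar>\<Sum>u\<in>A. s u * d u\<bar> = \<theta>"
    using T(2) abs_le_square_iff[of "\<Sum>u\<in>A. s u * d u" \<theta>] abs_le_square_iff[of \<theta> "\<Sum>u\<in>A. s u * d u"]
    by (simp add: \<theta>_def)
  then have L: "\<bar>\<Sum>u\<in>V. s u * d u\<bar> \<le> \<theta> + r * (2 * m)"
    using L2 splitV[of "\<lambda>u. s u * d u"] by linarith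

  \<comment> \<open>Edge counts by type and the quadratic form\<close>
  define EA where "EA = (\<Sum>u\<in>A. \<Sum>v\<in>A. adj E u v)"
  define EAB where "EAB = (\<Sum>u\<in>A. \<Sum>v\<in>B. adj E u v)"
  define EB where "EB = (\<Sum>u\<in>B. \<Sum>v\<in>B. adj E u v)"
  have EB0: "0 \<le> EB" by (simp add: EB_def sum_nonneg adj_nonneg)
  have "EA \<le> (\<Sum>u\<in>A. real (card A) * 1)"
    unfolding EA_def by (intro sum_mono sum_bounded_above adj_le_1)
  then have EAa: "EA \<le> a\<^sup>2" by (simp add: a power2_eq_square)
  have EBA: "(\<Sum>u\<in>B. \<Sum>v\<in>A. adj E u v) = EAB"
    unfolding EAB_def by (subst sum.swap) (simp only: adj_commute)
  have edges: "2 * m = EA + 2 * EAB + EB"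
    using double_sum_adj_all[OF G] EBA m unfolding splitV sum.distrib EA_def EAB_def EB_def by simp
  have dA: "sum d A = EA + EAB"
    unfolding d_def vertex_degree_eq_sum[OF G] splitV sum.distrib EA_def EAB_def by simp

  define RA where "RA = (\<Sum>u\<in>A. \<Sum>v\<in>A. adj E u v * (f u * f v))"
  define RB where "RB = (\<Sum>u\<in>B. \<Sum>v\<in>{v\<in>B. star_group c H v = star_group c H u}.
    adj E u v * (centre_sign c u * centre_sign c v))"
  have RA: "RA \<le> EA"
    unfolding RA_def EA_def
  proof (intro sum_mono)
    fix u v show "adj E u v * (f u * f v) \<le> adj E u v"
      using f[of u] f[of v] adj_nonneg[of E u v] by auto
  qed
  have RB: "RB \<le> 0" "3 * RB \<le> EB - 4 * real (card H)"
    unfolding RB_def EB_def by (rule star_groups_sums[OF c BB fin(3) loopfree H]; assumption)+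
  have R0: "(\<Sum>u\<in>V. \<Sum>v\<in>{v\<in>V. g v = g u}. adj E u v * (f u * f v)) = RB + RA"
    unfolding splitV RA_def RB_def
    by (intro arg_cong2[where f = "(+)"] sum.cong) (auto simp: gA gB f_def B_def)

  have "2 * \<theta> + (RB + RA) \<le> 2 * m / 3 + 4 / 3 * (EA + a + lost)"
  proof (cases "3 * \<theta> \<le> sum d A")
    \<comment> \<open>Since \<open>2 * m / 3\<close> is a third of \<open>EA + 2 * EAB + EB\<close>,
      it covers two thirds of \<open>EAB\<close>; what is left over is at most
      \<open>4 / 3 * EA\<close>.\<close>
    case True
    moreover have "0 \<le> a" "0 \<le> lost" by (simp_all add: a lost_def)
    ultimately show ?thesis using RA RB EB0 edges dA by argo
  next
    \<comment> \<open>Now \<theta> is at most \<open>a + card B'\<close> as well as at most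
      \<open>sum d A\<close>. Weighting these bounds by 4/3 and 2/3 costs
      \<open>4 / 3 * card H\<close>, which is exactly the gain from the stars in
      \<open>3 * RB\<close>.\<close>
    case False
    then obtain v where v: "v \<in> A" "T = {v}" using Tcases by (auto simp: \<theta>_def)
    have "sum d A = d v + sum d (A - {v})" by (rule sum.remove[OF fin(2) v(1)])
    moreover have "\<theta> = d v - sum d (A - {v})" by (simp add: \<theta>_def v)
    moreover have "d v \<le> a + real (card B') + sum d (A - {v})"
      using degree_le_nonisolated[OF G deg AV v(1)] by (simp add: a d_def B'_def B_def)
    moreover have "0 \<le> sum d (A - {v})" by (simp add: d_def sum_nonneg)
    ultimately show ?thesis using RA RB edges dA cardB' by argo
  qed
  then have main: "2 * \<theta> + (RB + RA) \<le> 2 * m / 3 + 4 / 3 * (a\<^sup>2 + a + 4 * \<gamma> * m / \<delta>\<^sup>2)"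
    using EAa lost by argo

  have edges_le: "8 * real (edges_inside E {u\<in>V. s u = t})
      \<le> 8 * m / 3 + 4 / 3 * (a\<^sup>2 + a + 4 * \<gamma> * m / \<delta>\<^sup>2) + 4 * r * m + 2 * \<delta> * m"
    if t: "t = 1 \<or> t = -1" for t
  proof -
    have "t * (\<Sum>u\<in>V. s u * d u) \<le> \<theta> + r * (2 * m)" using L t by auto
    then show ?thesis
      using edges_inside_signs[where s = s, OF G s t] sR main
      unfolding R0 d_def m(1)[symmetric] mult.assoc[of 2 t] by argo
  qed
  have "{u\<in>V. s u = 1} \<union> {u\<in>V. s u = -1} = V" using s by auto
  moreover have "{u\<in>V. s u = 1} \<inter> {u\<in>V. s u = -1} = {}" by auto
  moreover have "\<bar>real (card {u\<in>V. s u = 1}) - real (card {u\<in>V. s u = -1})\<bar> \<le> a + r * n"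
    unfolding card_diff_signs[where s = s, OF fin(1) s] by (rule bal)
  ultimately show ?thesis using edges_le by blast
qed

theorem theorem1p8:
  fixes \<epsilon> :: real
  assumes "\<epsilon> > 0"
  shows "\<exists>n0 :: nat. \<forall>(V :: 'a set) (E :: 'a set set).
           simple_graph V E \<and> card V > n0 \<and> min_vertex_degree V E \<ge> 2 \<longrightarrow>
           (\<exists>V1 V2. bisection V V1 V2 \<and>
              real (edges_inside E V1) \<le> (1/3 + \<epsilon>) * real (card E) \<and>
              real (edges_inside E V2) \<le> (1/3 + \<epsilon>) * real (card E))"
proof -
  \<comment> \<open>All error terms are to become multiples of \<open>r * m\<close>:
    \<open>\<delta>\<close> is the largest value with \<open>6 * \<delta>\<close> at most
    \<open>r\<^sup>2\<close>, and \<open>\<gamma>\<close> makes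
    \<open>4 * \<gamma> * m / \<delta>\<^sup>2\<close> equal to \<open>r * m\<close>.\<close>
  define r where "r = min \<epsilon> 1 / 8"
  define \<delta> where "\<delta> = r\<^sup>2 / 6"
  define \<gamma> where "\<gamma> = \<delta>\<^sup>2 * r / 4"
  \<comment> \<open>As the degrees sum to \<open>2 * m\<close>, at most \<open>2 / \<gamma>\<close>
    vertices have degree \<open>\<gamma> * m\<close> or more. Then \<open>n0\<close> ensures that
    \<open>K\<^sup>2 + K\<close> is at most \<open>r * n\<close> and that
    \<open>\<gamma> * n\<close> is at least 1.\<close>
  define K where "K = 2 / \<gamma>"
  define n0 where "n0 = nat \<lceil>(K\<^sup>2 + K) / r + 1 / \<gamma>\<rceil>"
  have r: "0 < r" "r \<le> 1 / 8" "8 * r \<le> \<epsilon>" using assms by (auto simp: r_def)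
  have "r\<^sup>2 \<le> r" using r by (simp add: power2_eq_square mult_left_le)
  then have \<delta>: "0 < \<delta>" "\<delta> \<le> r / 6" using r by (auto simp: \<delta>_def)
  have "\<delta>\<^sup>2 * r \<le> \<delta>\<^sup>2 * 1" using r by (intro mult_left_mono) auto
  then have \<gamma>: "0 < \<gamma>" "4 * \<gamma> \<le> \<delta>\<^sup>2" using r \<delta> by (auto simp: \<gamma>_def)
  have K: "0 < K" using \<gamma> by (simp add: K_def)
  show ?thesis
  proof (intro exI[of _ n0] allI impI, elim conjE)
    fix V :: "'a set" and E :: "'a set set"
    assume G: "simple_graph V E" and big: "n0 < card V" and mindeg: "2 \<le> min_vertex_degree V E"
    define n where "n = real (card V)"
    define m where "m = real (card E)"
    have fin: "finite V" using simple_graph_finite[OF G] by simp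
    have ne: "V \<noteq> {}" using big by auto
    have deg: "2 \<le> vertex_degree E u" if "u \<in> V" for u
      using mindeg that fin ne unfolding min_vertex_degree_def by (simp add: Min_ge_iff)
    have "(K\<^sup>2 + K) / r + 1 / \<gamma> \<le> n"
      using big unfolding n0_def n_def by linarith
    moreover have "0 \<le> (K\<^sup>2 + K) / r" "0 < 1 / \<gamma>" using K r \<gamma> by auto
    ultimately have n1: "(K\<^sup>2 + K) / r \<le> n" and n2: "1 / \<gamma> \<le> n" and n: "0 < n" by linarith+
    have Kn: "K\<^sup>2 + K \<le> r * n" using n1 r by (simp add: pos_divide_le_eq mult.commute)
    have \<gamma>n: "1 \<le> \<gamma> * n" using n2 \<gamma> by (simp add: pos_divide_le_eq mult.commute)
    have "2 * n = (\<Sum>u\<in>V. 2)" by (simp add: n_def)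
    also have "\<dots> \<le> (\<Sum>u\<in>V. real (vertex_degree E u))"
    proof (rule sum_mono)
      fix u assume "u \<in> V"
      then show "2 \<le> real (vertex_degree E u)" using deg[of u] by simp
    qed
    \<comment> \<open>Minimum degree 2 turns bounds in terms of \<open>n\<close> into bounds in
      terms of \<open>m\<close>.\<close>
    finally have nm: "n \<le> m" unfolding sum_vertex_degree[OF G] m_def by simp
    define A where "A = {u\<in>V. \<gamma> * m \<le> real (vertex_degree E u)}"
    define a where "a = real (card A)"
    have a0: "0 \<le> a" by (simp add: a_def)
    have "a * (\<gamma> * m) = (\<Sum>u\<in>A. \<gamma> * m)" by (simp add: a_def)
    also have "\<dots> \<le> (\<Sum>u\<in>A. real (vertex_degree E u))"
      by (rule sum_mono) (simp add: A_def)
    also have "\<dots> \<le> (\<Sum>u\<in>V. real (vertex_degree E u))"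
      using fin by (intro sum_mono2) (auto simp: A_def)
    also have "\<dots> = 2 * m" by (simp add: sum_vertex_degree[OF G] m_def)
    finally have "(a * \<gamma>) * m \<le> 2 * m" by (simp add: mult.assoc)
    then have "a * \<gamma> \<le> 2" using nm n by (metis less_le_trans mult_right_le_imp_le)
    then have aK: "a \<le> K" using \<gamma> by (simp add: K_def pos_le_divide_eq)
    have "a\<^sup>2 \<le> K\<^sup>2" using aK a0 by (simp add: power_mono)
    moreover have "r * n \<le> r * m" using nm r by simp
    ultimately have am: "a\<^sup>2 + a \<le> r * m" using aK Kn by linarith
    have "0 \<le> K\<^sup>2" by simp
    then have an: "a \<le> r * n" using aK Kn by linarith
    have "1 / n \<le> \<gamma>" using \<gamma>n n by (simp add: pos_divide_le_eq)
    then have c1: "\<gamma> / 2 + 1 / n \<le> \<delta>\<^sup>2" using \<gamma> by linarith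
    have c2: "1 \<le> \<gamma> * m" using \<gamma>n nm \<gamma>(1) by (meson less_imp_le mult_left_mono order_trans)
    have lost: "4 * \<gamma> * m / \<delta>\<^sup>2 = r * m" using \<delta> by (simp add: \<gamma>_def)
    have "0 < m" using n nm by linarith
    have \<delta>1: "\<delta> \<le> 1" using \<delta> r by linarith
    have \<delta>r: "6 * \<delta> \<le> r\<^sup>2" by (simp add: \<delta>_def)
    obtain W1 W2 where W: "W1 \<union> W2 = V" "W1 \<inter> W2 = {}"
      and bal: "\<bar>real (card W1) - real (card W2)\<bar> \<le> a + r * n"
      and edges: "\<And>W. W \<in> {W1, W2} \<Longrightarrow> 8 * real (edges_inside E W)
        \<le> 8 * m / 3 + 4 / 3 * (a\<^sup>2 + a + 4 * \<gamma> * m / \<delta>\<^sup>2) + 4 * r * m + 2 * \<delta> * m"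
      using near_bisection[OF G deg m_def \<open>0 < m\<close> n_def n \<delta>(1) \<delta>1 less_imp_le[OF r(1)] \<delta>r \<gamma>(1) c2 c1
        a_def[unfolded A_def]] by metis
    \<comment> \<open>The errors add up to at most 8/3 + 4 + 1/3 = 7 times \<open>r * m\<close>,
      which is below \<open>8 * (r * m)\<close>.\<close>
    define M where "M = m / 3 + r * m"
    have "\<delta> * m \<le> (r / 6) * m" using \<delta>(2) \<open>0 < m\<close> by (intro mult_right_mono) auto
    moreover have "0 \<le> r * m" using r \<open>0 < m\<close> by simp
    ultimately have M: "real (edges_inside E W) \<le> M" if "W \<in> {W1, W2}" for W
      using edges[OF that, unfolded lost] am unfolding M_def mult.assoc[of 4] mult.assoc[of 2] by argo
    obtain V1 V2 where "bisection V V1 V2"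
      and e: "real (edges_inside E V1) \<le> M + 2 * (a + r * n) * real (card E) / real (card V)"
        "real (edges_inside E V2) \<le> M + 2 * (a + r * n) * real (card E) / real (card V)"
      using rebalance[OF G W ne M M bal] by auto
    \<comment> \<open>Rebalancing costs at most \<open>4 * (r * m)\<close>, so the total excess over
      \<open>m / 3\<close> is at most \<open>5 * (r * m)\<close>, within the allowed
      \<open>8 * r * m\<close>.\<close>
    have "2 * (a + r * n) * m \<le> (4 * r * n) * m"
      using an \<open>0 < m\<close> by (intro mult_right_mono) (simp_all add: algebra_simps)
    then have "2 * (a + r * n) * m / n \<le> 4 * (r * m)"
      using n by (simp add: pos_divide_le_eq ac_simps)
    moreover have "8 * r * m \<le> \<epsilon> * m" using r(3) \<open>0 < m\<close> by (intro mult_right_mono) auto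
    moreover have "0 \<le> r * m" using r \<open>0 < m\<close> by simp
    ultimately have "M + 2 * (a + r * n) * m / n \<le> (1/3 + \<epsilon>) * m"
      unfolding M_def distrib_right mult.assoc[of 8] by argo
    then show "\<exists>V1 V2. bisection V V1 V2 \<and>
        real (edges_inside E V1) \<le> (1/3 + \<epsilon>) * real (card E) \<and>
        real (edges_inside E V2) \<le> (1/3 + \<epsilon>) * real (card E)"
      using e \<open>bisection V V1 V2\<close> unfolding m_def n_def by (meson order_trans)
  qed
qed

end
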